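(* Let $H_0$ be the Hankel operator with kernel $h_0(t)=(t+r)^{-q}e^{-\alpha t}$, where $r\ge 0$ and either $\alpha>0$, $q\ge 1$, or $\alpha=0$, $q>0$. Let $V$ be the Hankel operator with kernel $v(t)=v_0(t+\rho)^k e^{-\beta t}$, where $v_0\in\mathbb R$, $\rho\ge 0$, $\beta>0$ and $k\ge 0$. Then $$N_-(H_0+V)=N_-(V).$$
   Context: $\mathbb R_+=(0,\infty)$ and $(\mathsf L f)(\lambda)=\int_0^\infty e^{-t\lambda}f(t)\,dt$. The operator $H_0$ is the nonnegative self-adjoint operator in $L^2(\mathbb R_+)$ corresponding to the closed form $$h_0[f,f]=\frac{e^{\alpha r}}{\Gamma(q)}\int_\alpha^\infty(\lambda-\alpha)^{q-1}e^{-r\lambda}|(\mathsf L f)(\lambda)|^2\,d\lambda$$ with domain $\mathcal D[h_0]$ the set of all $f\in L^2(\mathbb R_+)$ for which this integral is finite; on $C_0^\infty(\mathbb R_+)$ this form equals $\int_0^\infty\int_0^\infty h_0(t+s)f(s)\overline{f(t)}\,dt\,ds$, and $h_0[\cdot,\cdot]$ is the closure of its restriction to $C_0^\infty(\mathbb R_+)$. The operator $V$, $(Vf)(t)=\int_0^\infty v(t+s)f(s)\,ds$, is bounded and self-adjoint. $H_0+V$ is the self-adjoint operator corresponding to the closed form $h_0[f,f]+(Vf,f)$ on $\mathcal D[h_0]$. For a self-adjoint operator $A$ bounded from below with quadratic form $a$, $N_-(A)\in\{0,1,2,\dots\}\cup\{\infty\}$ is the total number of negative eigenvalues (total multiplicity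 of the negative spectrum), i.e. the maximal dimension of linear subsets of the form domain on which $a[f,f]<0$ for all $f\ne0$. *)

theory Defs
  imports "HOL-Analysis.Analysis" "HOL-Library.Function_Algebras"
begin

text \<open>
  The space \<open>L\<^sup>2(0,\<infinity>)\<close> is represented by its square integrable functions
  \<open>real \<Rightarrow> complex\<close>, of which only the restriction to \<open>{0<..}\<close> matters. Requiring Borel rather than
  Lebesgue measurability is no restriction, since every class contains a Borel function.
\<close>

definition L2_pos :: "(real \<Rightarrow> complex) set" where
  "L2_pos = {f. set_borel_measurable lborel {0<..} f \<and>
                set_integrable lborel {0<..} (\<lambda>t. (cmod (f t))\<^sup>2)}"

definition inner_pos :: "(real \<Rightarrow> complex) \<Rightarrow> (real \<Rightarrow> complex) \<Rightarrow> complex" where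
  "inner_pos f g = (LINT t:{0<..}|lborel. f t * cnj (g t))"

definition laplace :: "(real \<Rightarrow> complex) \<Rightarrow> real \<Rightarrow> complex" where
  "laplace f x = (LINT t:{0<..}|lborel. of_real (exp (- t * x)) * f t)"

definition hankel :: "(real \<Rightarrow> real) \<Rightarrow> (real \<Rightarrow> complex) \<Rightarrow> real \<Rightarrow> complex" where
  "hankel v f t = (LINT s:{0<..}|lborel. of_real (v (t + s)) * f s)"

text \<open>
  The Hankel operator with kernel \<open>(t + r)\<^sup>-\<^sup>q e\<^sup>-\<^sup>\<alpha>\<^sup>t\<close> may be unbounded, and its integral need not
  converge on all of the operator domain. It is given by its closed quadratic form, whose domain is
  \<open>H0_dom \<alpha> q r\<close>; the lemma \<open>H0_kernel\<close> below recovers the kernel from the weight.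
\<close>

definition H0_weight :: "real \<Rightarrow> real \<Rightarrow> real \<Rightarrow> real \<Rightarrow> real" where
  "H0_weight \<alpha> q r x = (x - \<alpha>) powr (q - 1) * exp (- r * x)"

definition H0_dom :: "real \<Rightarrow> real \<Rightarrow> real \<Rightarrow> (real \<Rightarrow> complex) set" where
  "H0_dom \<alpha> q r = {f \<in> L2_pos.
     set_integrable lborel {\<alpha><..} (\<lambda>x. H0_weight \<alpha> q r x * (cmod (laplace f x))\<^sup>2)}"

definition H0_form :: "real \<Rightarrow> real \<Rightarrow> real \<Rightarrow> (real \<Rightarrow> complex) \<Rightarrow> real" where
  "H0_form \<alpha> q r f = exp (\<alpha> * r) / Gamma q *
     (LINT x:{\<alpha><..}|lborel. H0_weight \<alpha> q r x * (cmod (laplace f x))\<^sup>2)"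

lemma H0_kernel:
  assumes "q > 0" "r \<ge> 0" "t > 0"
  shows "exp (\<alpha> * r) / Gamma q * (LINT x:{\<alpha><..}|lborel. H0_weight \<alpha> q r x * exp (- t * x))
         = (t + r) powr (- q) * exp (- \<alpha> * t)"
proof -
  define c where "c = t + r"
  have c: "c > 0" using assms by (simp add: c_def)
  define g :: "real \<Rightarrow> real" where "g x = indicator {0<..} x * (x powr (q - 1) / exp x)" for x
  have int: "integral\<^sup>L lborel g = Gamma q"
  proof -
    have "((\<lambda>x. x powr (q - 1) / exp x) has_integral Gamma q) {0..}"
      using Gamma_integral_real[of q] assms by simp
    then have "((\<lambda>x. if x \<in> {0..} then x powr (q - 1) / exp x else 0) has_integral Gamma q) UNIV"
      by (subst has_integral_restrict_UNIV)
    then have hi: "(g has_integral Gamma q) UNIV"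
      by (rule has_integral_spike[of "{0}", rotated 2]) (auto simp: g_def)
    have g: "g \<in> borel_measurable borel" "\<And>x. 0 \<le> g x"
      unfolding g_def by measurable
    have "(\<integral>\<^sup>+x. g x \<partial>lborel) = Gamma q"
      using nn_integral_has_integral_lborel[OF g hi] .
    then have "has_bochner_integral lborel g (Gamma q)"
      using g assms Gamma_real_pos[of q] by (intro has_bochner_integral_nn_integral) auto
    then show ?thesis by (rule has_bochner_integral_integral_eq)
  qed
  have "(LINT x:{\<alpha><..}|lborel. H0_weight \<alpha> q r x * exp (- t * x))
        = (LINT x|lborel. indicator {\<alpha><..} x * (H0_weight \<alpha> q r x * exp (- t * x)))"
    by (simp add: set_lebesgue_integral_def)
  also have "\<dots> = (1 / c) * (LINT x|lborel. indicator {\<alpha><..} (\<alpha> + (1/c) * x) *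
                 (H0_weight \<alpha> q r (\<alpha> + (1/c) * x) * exp (- t * (\<alpha> + (1/c) * x))))"
    using c by (subst lborel_integral_real_affine[where c = "1/c" and t = \<alpha>]) auto
  also have "(LINT x|lborel. indicator {\<alpha><..} (\<alpha> + (1/c) * x) *
                 (H0_weight \<alpha> q r (\<alpha> + (1/c) * x) * exp (- t * (\<alpha> + (1/c) * x))))
      = (LINT x|lborel. (c powr (1 - q) * exp (- \<alpha> * c)) * g x)"
  proof (rule Bochner_Integration.integral_cong[OF refl])
    fix x :: real
    have *: "- r * (\<alpha> + (1/c) * x) + - t * (\<alpha> + (1/c) * x) = - \<alpha> * c + - x"
    proof -
      have "- r * (\<alpha> + (1/c) * x) + - t * (\<alpha> + (1/c) * x) = - c * (\<alpha> + (1/c) * x)"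
        unfolding ring_distribs(2)[symmetric] by (simp add: c_def)
      also have "\<dots> = - \<alpha> * c + - x" using c by (simp add: field_simps)
      finally show ?thesis .
    qed
    show "indicator {\<alpha><..} (\<alpha> + (1/c) * x) *
         (H0_weight \<alpha> q r (\<alpha> + (1/c) * x) * exp (- t * (\<alpha> + (1/c) * x)))
        = (c powr (1 - q) * exp (- \<alpha> * c)) * g x"
    proof (cases "x > 0")
      case True
      have "((1/c) * x) powr (q - 1) = c powr (1 - q) * x powr (q - 1)"
        using c True by (simp add: powr_divide powr_diff)
      moreover have "exp (- r * (\<alpha> + (1/c) * x)) * exp (- t * (\<alpha> + (1/c) * x)) = exp (- \<alpha> * c) / exp x"
        unfolding exp_add[symmetric] * by (simp add: exp_diff)
      ultimately show ?thesis
        using c True by (simp add: H0_weight_def g_def mult.assoc)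
    next
      case False
      then have "indicator {\<alpha><..} (\<alpha> + (1/c) * x) = (0::real)"
        using c by (simp add: indicator_def divide_nonpos_pos not_less)
      then show ?thesis using False by (simp add: g_def)
    qed
  qed
  also have "\<dots> = c powr (1 - q) * exp (- \<alpha> * c) * Gamma q"
    by (simp add: int)
  also have "exp (\<alpha> * r) / Gamma q * (1 / c * (c powr (1 - q) * exp (- \<alpha> * c) * Gamma q))
      = (c powr (1 - q) / c) * (exp (\<alpha> * r) * exp (- \<alpha> * c))"
    using Gamma_real_pos[OF assms(1)] by (simp add: field_simps)
  also have "c powr (1 - q) / c = c powr (- q)"
    using c by (simp add: powr_diff powr_minus field_simps)
  also have "exp (\<alpha> * r) * exp (- \<alpha> * c) = exp (- \<alpha> * t)"
    unfolding exp_add[symmetric] by (simp add: c_def algebra_simps)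
  finally show ?thesis by (simp add: c_def)
qed

global_interpretation cfun: vector_space "\<lambda>(c::complex) (f::real \<Rightarrow> complex) t. c * f t"
  by unfold_locales (auto simp: fun_eq_iff algebra_simps)

text \<open>
  The value \<open>N\<^sub>-\<close> of a self-adjoint operator, bounded from below, whose quadratic form is \<open>a\<close> with
  domain \<open>D\<close>: the maximal dimension of complex linear subspaces of \<open>D\<close> on which \<open>a < 0\<close> off zero.
  Such a form vanishes on functions that are zero almost everywhere in \<open>{0<..}\<close>, so the span of \<open>B\<close>
  contains no nonzero null function and its dimension in \<open>L\<^sup>2\<close> is \<open>card B\<close>. For \<open>B = {}\<close> the
  conditions are trivially satisfied, and a supremum over unbounded cardinalities is \<open>\<infinity>\<close>.
\<close>

definition N_minus :: "(real \<Rightarrow> complex) set \<Rightarrow> ((real \<Rightarrow> complex) \<Rightarrow> real) \<Rightarrow> enat" where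
  "N_minus D a = Sup {enat (card B) | B. finite B \<and> cfun.independent B \<and> cfun.span B \<subseteq> D \<and>
                        (\<forall>f\<in>cfun.span B. f \<noteq> 0 \<longrightarrow> a f < 0)}"

definition V_kernel :: "real \<Rightarrow> real \<Rightarrow> real \<Rightarrow> real \<Rightarrow> real \<Rightarrow> real" where
  "V_kernel v\<^sub>0 \<rho> k \<beta> t = v\<^sub>0 * (t + \<rho>) powr k * exp (- \<beta> * t)"

text \<open>
  The form of a bounded self-adjoint Hankel operator. The inner product is then real, and \<open>Re\<close> only
  changes its type.
\<close>

definition hankel_form :: "(real \<Rightarrow> real) \<Rightarrow> (real \<Rightarrow> complex) \<Rightarrow> real" where
  "hankel_form v f = Re (inner_pos (hankel v f) f)"

end

theory Submission
  imports Defs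
begin

text \<open>
  Both quadratic forms see a function \<open>f\<close> only through its Laplace transform \<open>Lf\<close>. Put
  \<open>E x = e\<^sup>-\<^sup>\<rho>\<^sup>x |(Lf)(\<beta> + x)|\<^sup>2\<close> and let \<open>n\<close> be the least integer above \<open>k\<close>. If \<open>k\<close> is an integer, the
  form of \<open>V\<close> is \<open>v\<^sub>0 (-1)\<^sup>k\<close> times the \<open>k\<close>-th derivative of \<open>E\<close> at \<open>0\<close>. Otherwise it is a constant of
  the sign of \<open>v\<^sub>0 (-1)\<^sup>n\<close> times the integral over \<open>x > 0\<close> of \<open>x\<^sup>-\<^sup>k\<^sup>-\<^sup>1 (E x - T x)\<close>, where \<open>T\<close> is the
  Taylor polynomial of \<open>E\<close> at \<open>0\<close> of degree \<open>n - 1\<close> (\<open>hankel_form_fractional\<close>). So \<open>V\<close> is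
  governed by a singularity at \<open>\<beta>\<close>, whereas \<open>H\<^sub>0\<close> integrates \<open>|Lf|\<^sup>2\<close> against a density that is
  bounded near \<open>\<beta>\<close>: the form of \<open>H\<^sub>0\<close> becomes negligible for Laplace transforms that are
  concentrated near \<open>\<beta>\<close>.

  Concentration is achieved by multiplying Laplace transforms. The product of \<open>Lf\<close> with
  \<open>1 / (x + b)\<close> is the transform of the convolution of \<open>f\<close> with \<open>e\<^sup>-\<^sup>b\<^sup>t\<close>, which is again square
  integrable (\<open>laplace_resolvent\<close>). Hence polynomials in such functions are multipliers, among
  them \<open>bump b x = 4bx / (x + b)\<^sup>2\<close>, which equals \<open>1\<close> at \<open>b\<close> and is smaller than \<open>1\<close> elsewhere on
  \<open>(0, \<infinity>)\<close>.

  Since \<open>H\<^sub>0 \<ge> 0\<close>, only \<open>N\<^sub>-(V) \<le> N\<^sub>-(H\<^sub>0 + V)\<close> needs an argument. There are two cases.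

  \<^item> If \<open>k\<close> is an integer or \<open>v\<^sub>0 (-1)\<^sup>n \<ge> 0\<close>, a space on which \<open>V\<close> is negative is moved by the
    multiplier \<open>1 - (1 - bump\<^sup>N)\<^sup>n\<close>. It lies in \<open>[0,1]\<close> and agrees with \<open>1\<close> to order \<open>2n\<close> at \<open>\<beta>\<close>.
    So \<open>T\<close> is unchanged and \<open>E\<close> does not grow, and the form of \<open>V\<close> does not increase
    (\<open>hankel_form_decreasing\<close>), while the form of \<open>H\<^sub>0\<close> tends to \<open>0\<close> as \<open>N\<close> grows. Compactness of
    the unit sphere makes this uniform on the space (\<open>negative_space_survives\<close>).

  \<^item> Otherwise, on functions with \<open>T = 0\<close> the form of \<open>V\<close> is a negative multiple of the integral of
    \<open>x\<^sup>-\<^sup>k\<^sup>-\<^sup>1 E x\<close>. Its density exceeds that of \<open>H\<^sub>0\<close> on a short interval to the right of \<open>\<beta>\<close>, and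
    spaces of every dimension can be concentrated there. So \<open>N\<^sub>-(H\<^sub>0 + V) = \<infinity>\<close>
    (\<open>negative_spaces_unbounded\<close>), and then \<open>N\<^sub>-(V) = \<infinity>\<close> as well.
\<close>

section \<open>Square integrable functions and their Laplace transforms\<close>

lemma has_bochner_integral_of_nonneg_has_integral:
  fixes f :: "real \<Rightarrow> real"
  assumes "f \<in> borel_measurable borel" "S \<in> sets borel" "\<And>x. x \<in> S \<Longrightarrow> 0 \<le> f x" "(f has_integral I) S"
  shows "has_bochner_integral lborel (\<lambda>x. indicator S x *\<^sub>R f x) I"
proof -
  have eq: "(\<lambda>x. if x \<in> S then f x else 0) = (\<lambda>x. indicator S x *\<^sub>R f x)"
    by (auto simp: indicator_def)
  have hi: "((\<lambda>x. indicator S x *\<^sub>R f x) has_integral I) UNIV"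
    using assms(4) has_integral_restrict_UNIV[of S f I] eq by simp
  have m: "(\<lambda>x. indicator S x *\<^sub>R f x) \<in> borel_measurable borel"
    using assms(1,2) by (intro borel_measurable_scaleR borel_measurable_indicator) auto
  have n: "0 \<le> indicator S x *\<^sub>R f x" for x using assms(3) by (simp add: indicator_def)
  have "I \<ge> 0" using has_integral_nonneg[OF assms(4)] assms(3) by auto
  moreover have "(\<integral>\<^sup>+x. indicator S x *\<^sub>R f x \<partial>lborel) = I"
    using nn_integral_has_integral_lborel[OF m n hi] .
  ultimately show ?thesis using m n by (intro has_bochner_integral_nn_integral) auto
qed

text \<open>
  The exponential cut off at the origin turns convolutions on the half-line into convolutions on the
  whole line, to which the translation invariance of \<open>lborel\<close> applies.
\<close>

definition exp_tail :: "real \<Rightarrow> real \<Rightarrow> real" where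
  "exp_tail b x = (if 0 < x then exp (- (b * x)) else 0)"

lemma exp_tail_measurable [measurable]: "exp_tail b \<in> borel_measurable borel"
  unfolding exp_tail_def by measurable

lemma exp_tail_nonneg [simp]: "0 \<le> exp_tail b x" by (simp add: exp_tail_def)

lemma has_bochner_integral_exp_tail:
  assumes "b > 0" shows "has_bochner_integral lborel (exp_tail b) (1 / b)"
proof -
  have "((\<lambda>x. exp (- b * x)) has_integral exp (- b * 0) / b) {0..}"
    using has_integral_exp_minus_to_infinity[of b 0] assms by simp
  then have "((\<lambda>x. exp (- b * x)) has_integral 1 / b) {0<..}"
    by (subst has_integral_spike_set_eq[of "{0<..}" "{0..}"])
       (auto intro: negligible_subset[of "{0::real}"] simp: less_le)
  then have "has_bochner_integral lborel (\<lambda>x. indicator {0<..} x *\<^sub>R exp (- b * x)) (1 / b)"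
    by (intro has_bochner_integral_of_nonneg_has_integral) auto
  moreover have "(\<lambda>x. indicator {0<..} x *\<^sub>R exp (- b * x)) = exp_tail b"
    by (auto simp: exp_tail_def indicator_def)
  ultimately show ?thesis by simp
qed

lemma has_bochner_integral_exp_tail_shift:
  assumes "b > 0"
  shows "has_bochner_integral lborel (\<lambda>t. exp_tail b (t - s)) (1 / b)"
    and "has_bochner_integral lborel (\<lambda>s. exp_tail b (t - s)) (1 / b)"
  using has_bochner_integral_exp_tail[OF assms]
    lborel_has_bochner_integral_real_affine_iff[of 1 "exp_tail b" "1/b" "-s"]
    lborel_has_bochner_integral_real_affine_iff[of "-1" "exp_tail b" "1/b" t]
  by simp_all

definition zext :: "(real \<Rightarrow> complex) \<Rightarrow> real \<Rightarrow> complex" where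
  "zext f t = indicator {0<..} t *\<^sub>R f t"

lemma zext_measurable [measurable]: "f \<in> L2_pos \<Longrightarrow> zext f \<in> borel_measurable borel"
  unfolding zext_def[abs_def] by (auto simp: L2_pos_def set_borel_measurable_def)

lemma zext_square_integrable: 
  assumes "f \<in> L2_pos" shows "integrable lborel (\<lambda>t. (cmod (zext f t))\<^sup>2)"
proof -
  have "(\<lambda>t. (cmod (zext f t))\<^sup>2) = (\<lambda>t. indicator {0<..} t *\<^sub>R (cmod (f t))\<^sup>2)"
    by (auto simp: zext_def indicator_def)
  then show ?thesis using assms by (auto simp: L2_pos_def set_integrable_def)
qed

lemma L2_posI:
  assumes "zext f \<in> borel_measurable borel" "integrable lborel (\<lambda>t. (cmod (zext f t))\<^sup>2)"
  shows "f \<in> L2_pos"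
proof -
  have "(\<lambda>t. (cmod (zext f t))\<^sup>2) = (\<lambda>t. indicator {0<..} t *\<^sub>R (cmod (f t))\<^sup>2)"
    by (auto simp: zext_def indicator_def)
  then show ?thesis using assms by (auto simp: L2_pos_def set_integrable_def set_borel_measurable_def zext_def[abs_def])
qed

lemma zext_pos [simp]: "t > 0 \<Longrightarrow> zext f t = f t"
  by (simp add: zext_def)

lemma zext_nonpos [simp]: "t \<le> 0 \<Longrightarrow> zext f t = 0"
  by (simp add: zext_def)

lemma laplace_zext: "laplace f x = (LINT t|lborel. exp (- (t * x)) *\<^sub>R zext f t)"
  unfolding laplace_def set_lebesgue_integral_def zext_def
  by (intro Bochner_Integration.integral_cong) (auto simp: indicator_def scaleR_conv_of_real)

text \<open>
  The inequality \<open>2ab \<le> a\<^sup>2 + b\<^sup>2\<close> gives convergence of the Laplace integral and the bound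
  \<open>laplace_bound\<close>. That bound is weaker at \<open>0\<close> and at infinity than the one from the Cauchy-Schwarz
  inequality, which is harmless because the multipliers below decay to any order at both ends.
\<close>

lemma exp_zext_bound:
  "norm (exp (- (t * a)) *\<^sub>R zext f t) \<le> (exp_tail (2 * a) t + (cmod (zext f t))\<^sup>2) / 2"
proof (cases "t > 0")
  case True
  have "exp_tail (2 * a) t = (exp (- (t * a)))\<^sup>2"
    using True by (simp add: exp_tail_def power2_eq_square flip: exp_add)
  then show ?thesis
    using sum_squares_bound[of "exp (- (t * a))" "cmod (zext f t)"] by (simp add: mult.commute)
qed simp

lemma exp_zext_integrable:
  assumes "f \<in> L2_pos" "a > 0"
  shows "integrable lborel (\<lambda>t. exp (- (t * a)) *\<^sub>R zext f t)"
proof (rule Bochner_Integration.integrable_bound)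
  show "integrable lborel (\<lambda>t. (exp_tail (2 * a) t + (cmod (zext f t))\<^sup>2) / 2)"
    using has_bochner_integral_exp_tail[of "2 * a"] zext_square_integrable[OF assms(1)] assms(2)
    by (auto simp: has_bochner_integral_iff)
  show "AE t in lborel. norm (exp (- (t * a)) *\<^sub>R zext f t)
          \<le> norm ((exp_tail (2 * a) t + (cmod (zext f t))\<^sup>2) / 2)"
    using exp_zext_bound[of _ a f] by (auto intro: order_trans[OF _ abs_ge_self])
qed (use assms in measurable)

lemma laplace_bound:
  assumes "f \<in> L2_pos"
  obtains C where "C \<ge> 0" "\<And>x. x > 0 \<Longrightarrow> cmod (laplace f x) \<le> C * (1 + 1 / x)"
proof
  define D where "D = (LINT t|lborel. (cmod (zext f t))\<^sup>2)"
  have D: "D \<ge> 0" by (simp add: D_def)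
  then show "0 \<le> 1 + D" by simp
  fix x :: real assume x: "x > 0"
  have "cmod (laplace f x) \<le> (LINT t|lborel. (exp_tail (2 * x) t + (cmod (zext f t))\<^sup>2) / 2)"
    unfolding laplace_zext
  proof (rule order_trans[OF integral_norm_bound integral_mono])
    show "integrable lborel (\<lambda>t. (exp_tail (2 * x) t + (cmod (zext f t))\<^sup>2) / 2)"
      using has_bochner_integral_exp_tail[of "2 * x"] zext_square_integrable[OF assms(1)] x
      by (auto simp: has_bochner_integral_iff)
    show "integrable lborel (\<lambda>t. norm (exp (- (t * x)) *\<^sub>R zext f t))"
      using exp_zext_integrable[OF assms x] by (rule integrable_norm)
  qed (rule exp_zext_bound)
  also have "\<dots> = (1 / (2 * x) + D) / 2"
    using has_bochner_integral_exp_tail[of "2 * x"] zext_square_integrable[OF assms(1)] x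
    by (auto simp: has_bochner_integral_iff D_def)
  also have "\<dots> \<le> (1 + D) * (1 + 1 / x)"
    using x D by (simp add: field_simps)
  finally show "cmod (laplace f x) \<le> (1 + D) * (1 + 1 / x)" .
qed

lemma laplace_measurable [measurable]:
  assumes [measurable]: "f \<in> L2_pos"
  shows "laplace f \<in> borel_measurable borel"
  unfolding laplace_zext[abs_def] by measurable

text \<open>
  The integral is exchanged with the convolution by Fubini; the mass of the exponential is \<open>1 / b\<close>.
\<close>

lemma exp_tail_convolution:
  fixes h :: "real \<Rightarrow> 'a :: {banach, second_countable_topology}"
  assumes b: "b > 0" and h: "integrable lborel h"
  shows "integrable lborel (\<lambda>t. LINT s|lborel. exp_tail b (t - s) *\<^sub>R h s)"
    and "(LINT t|lborel. LINT s|lborel. exp_tail b (t - s) *\<^sub>R h s) = (1 / b) *\<^sub>R (LINT s|lborel. h s)"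
proof -
  have [measurable]: "h \<in> borel_measurable lborel" using h by auto
  have e: "integrable lborel (\<lambda>t. exp_tail b (t - s))" "(LINT t|lborel. exp_tail b (t - s)) = 1 / b" for s
    using has_bochner_integral_exp_tail_shift(1)[OF b] by (auto simp: has_bochner_integral_iff)
  have i: "integrable (lborel \<Otimes>\<^sub>M lborel) (\<lambda>(s, t). exp_tail b (t - s) *\<^sub>R h s)"
  proof (rule lborel_pair.Fubini_integrable)
    show "AE s in lborel. integrable lborel (\<lambda>t. case (s, t) of (s, t) \<Rightarrow> exp_tail b (t - s) *\<^sub>R h s)"
      using e(1) by (intro AE_I2) (simp add: integrable_scaleR_left)
    have "(LINT t|lborel. norm (exp_tail b (t - s) *\<^sub>R h s)) = (1 / b) * norm (h s)" for s
      using e by simp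
    then show "integrable lborel (\<lambda>s. LINT t|lborel. norm (case (s, t) of (s, t) \<Rightarrow> exp_tail b (t - s) *\<^sub>R h s))"
      using h by simp
  qed measurable
  show "integrable lborel (\<lambda>t. LINT s|lborel. exp_tail b (t - s) *\<^sub>R h s)"
    using lborel_pair.integrable_snd[OF i] by simp
  have "(LINT t|lborel. LINT s|lborel. exp_tail b (t - s) *\<^sub>R h s)
      = (LINT s|lborel. LINT t|lborel. exp_tail b (t - s) *\<^sub>R h s)"
    using lborel_pair.Fubini_integral[OF i] by simp
  also have "\<dots> = (LINT s|lborel. (1 / b) *\<^sub>R h s)"
    using e by (intro Bochner_Integration.integral_cong) auto
  finally show "(LINT t|lborel. LINT s|lborel. exp_tail b (t - s) *\<^sub>R h s) = (1 / b) *\<^sub>R (LINT s|lborel. h s)"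
    by simp
qed

text \<open>
  The function \<open>g\<close> is the convolution of \<open>f\<close> with \<open>e\<^sup>-\<^sup>b\<^sup>t\<close>. It is square integrable because averaging
  with a kernel of finite mass preserves \<open>L\<^sup>2\<close>. For the Laplace transform, the factor \<open>e\<^sup>-\<^sup>t\<^sup>x\<close> is split
  as \<open>e\<^sup>-\<^sup>(\<^sup>t\<^sup>-\<^sup>s\<^sup>)\<^sup>x e\<^sup>-\<^sup>s\<^sup>x\<close>, which changes the rate of the kernel from \<open>b\<close> to \<open>b + x\<close>.
\<close>

lemma laplace_resolvent:
  assumes f: "f \<in> L2_pos" and b: "b > 0"
  obtains g where "g \<in> L2_pos" "\<And>x. x > 0 \<Longrightarrow> laplace g x = laplace f x / of_real (x + b)"
proof
  note [measurable] = zext_measurable[OF f]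
  let ?F = "zext f"
  define g where "g t = (LINT s|lborel. exp_tail b (t - s) *\<^sub>R ?F s)" for t
  have supp: "exp_tail b (t - s) *\<^sub>R ?F s = 0" if "t \<le> 0" for s t
    using that by (cases "s > 0") (auto simp: exp_tail_def)
  have g_nonpos: "g t = 0" if "t \<le> 0" for t
    unfolding g_def by (simp only: supp[OF that] Bochner_Integration.integral_zero)
  have zg: "zext g = g" using g_nonpos by (auto simp: zext_def indicator_def fun_eq_iff not_less)
  have gm [measurable]: "g \<in> borel_measurable borel" unfolding g_def[abs_def] by measurable
  define G2 where "G2 t = (LINT s|lborel. exp_tail b (t - s) * (cmod (?F s))\<^sup>2)" for t
  have G2: "integrable lborel G2"
    using exp_tail_convolution(1)[OF b zext_square_integrable[OF f]] by (simp add: G2_def[abs_def])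
  have bound: "(cmod (g t))\<^sup>2 \<le> G2 t / b" for t
  proof -
    have e: "integrable lborel (\<lambda>s. exp_tail b (t - s))" "(LINT s|lborel. exp_tail b (t - s)) = 1 / b"
      using has_bochner_integral_exp_tail_shift(2)[OF b] by (auto simp: has_bochner_integral_iff)
    have le1: "exp_tail b y \<le> 1" for y using b by (simp add: exp_tail_def)
    have i2: "integrable lborel (\<lambda>s. exp_tail b (t - s) * (cmod (?F s))\<^sup>2)"
      by (rule Bochner_Integration.integrable_bound[OF zext_square_integrable[OF f]])
         (use mult_right_mono[OF le1] in \<open>auto simp: abs_mult\<close>)
    \<comment> \<open>The Cauchy-Schwarz inequality for the measure with density \<open>exp_tail b (t - s)\<close>: integrate this estimate and take the optimal \<open>c = b A\<close>.\<close>
    have am: "2 * c * (exp_tail b (t - s) * cmod (?F s))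
           \<le> c\<^sup>2 * exp_tail b (t - s) + exp_tail b (t - s) * (cmod (?F s))\<^sup>2" for c s
    proof -
      have "exp_tail b (t - s) * (2 * c * cmod (?F s)) \<le> exp_tail b (t - s) * (c\<^sup>2 + (cmod (?F s))\<^sup>2)"
        using sum_squares_bound[of c "cmod (?F s)"] by (intro mult_left_mono) auto
      then show ?thesis by (simp add: algebra_simps)
    qed
    have le2: "exp_tail b (t - s) * cmod (?F s)
           \<le> \<bar>exp_tail b (t - s) + exp_tail b (t - s) * (cmod (?F s))\<^sup>2\<bar>" for s
      using am[of 1 s, simplified] mult_nonneg_nonneg[OF exp_tail_nonneg norm_ge_zero, of b "t - s" "?F s"]
      by linarith
    have i1: "integrable lborel (\<lambda>s. exp_tail b (t - s) * cmod (?F s))"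
      by (rule Bochner_Integration.integrable_bound[OF Bochner_Integration.integrable_add[OF e(1) i2]])
         (use le2 in \<open>auto simp: abs_mult intro!: AE_I2\<close>)
    define A where "A = (LINT s|lborel. exp_tail b (t - s) * cmod (?F s))"
    have gA: "cmod (g t) \<le> A"
      unfolding g_def A_def by (rule order_trans[OF integral_norm_bound]) simp
    have "(LINT s|lborel. 2 * (b * A) * (exp_tail b (t - s) * cmod (?F s)))
       \<le> (LINT s|lborel. (b * A)\<^sup>2 * exp_tail b (t - s) + exp_tail b (t - s) * (cmod (?F s))\<^sup>2)"
      using i1 i2 e(1) am[of "b * A"] by (intro integral_mono) auto
    then have "2 * (b * A) * A \<le> (b * A)\<^sup>2 * (1 / b) + G2 t"
      using i1 i2 e by (simp add: A_def G2_def)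
    then have "b * A\<^sup>2 \<le> G2 t" using b by (simp add: power2_eq_square algebra_simps)
    moreover have "(cmod (g t))\<^sup>2 \<le> A\<^sup>2" using gA by (intro power_mono) auto
    ultimately show ?thesis using b by (simp add: field_simps) (smt (verit) mult_left_mono mult.commute)
  qed
  show "g \<in> L2_pos"
  proof (rule L2_posI; unfold zg)
    show "integrable lborel (\<lambda>t. (cmod (g t))\<^sup>2)"
      by (rule Bochner_Integration.integrable_bound[where f="\<lambda>t. G2 t / b"])
         (use G2 b in \<open>auto intro!: AE_I2 order_trans[OF bound] divide_right_mono\<close>)
  qed measurable
  fix x :: real assume x: "x > 0"
  have shift: "exp (- (t * x)) * exp_tail b (t - s) = exp_tail (b + x) (t - s) * exp (- (s * x))" for t s
    by (auto simp: exp_tail_def algebra_simps simp flip: exp_add)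
  have "laplace g x = (LINT t|lborel. exp (- (t * x)) *\<^sub>R g t)"
    by (simp add: laplace_zext zg)
  also have "\<dots> = (LINT t|lborel. LINT s|lborel. exp_tail (b + x) (t - s) *\<^sub>R (exp (- (s * x)) *\<^sub>R ?F s))"
    unfolding g_def by (simp add: shift flip: integral_scaleR_right)
  also have "\<dots> = (1 / (b + x)) *\<^sub>R laplace f x"
    using exp_tail_convolution(2)[OF _ exp_zext_integrable[OF f x], of "b + x"] b x
    by (simp add: laplace_zext)
  finally show "laplace g x = laplace f x / of_real (x + b)"
    by (simp add: scaleR_conv_of_real add.commute)
qed

section \<open>Linear combinations and multipliers of Laplace transforms\<close>

definition lincomb :: "nat \<Rightarrow> (nat \<Rightarrow> complex) \<Rightarrow> (nat \<Rightarrow> real \<Rightarrow> complex) \<Rightarrow> real \<Rightarrow> complex" where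
  "lincomb n c b = (\<lambda>t. \<Sum>i<n. c i * b i t)"

lemma zext_linear:
  "zext (\<lambda>t. f t + g t) = (\<lambda>t. zext f t + zext g t)"
  "zext (\<lambda>t. c * f t) = (\<lambda>t. c * zext f t)"
  by (auto simp: zext_def fun_eq_iff indicator_def)

lemma L2_pos_zero [simp]: "(\<lambda>_. 0) \<in> L2_pos"
  by (rule L2_posI) (simp_all add: zext_def[abs_def])

lemma L2_pos_add:
  assumes "f \<in> L2_pos" "g \<in> L2_pos"
  shows "(\<lambda>t. f t + g t) \<in> L2_pos"
proof (rule L2_posI; unfold zext_linear)
  note [measurable] = zext_measurable[OF assms(1)] zext_measurable[OF assms(2)]
  show "(\<lambda>t. zext f t + zext g t) \<in> borel_measurable borel" by measurable
  show "integrable lborel (\<lambda>t. (cmod (zext f t + zext g t))\<^sup>2)"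
  proof (rule Bochner_Integration.integrable_bound)
    show "integrable lborel (\<lambda>t. 2 * (cmod (zext f t))\<^sup>2 + 2 * (cmod (zext g t))\<^sup>2)"
      using assms by (intro Bochner_Integration.integrable_add integrable_mult_right zext_square_integrable)
    have "(cmod (a + b))\<^sup>2 \<le> 2 * (cmod a)\<^sup>2 + 2 * (cmod b)\<^sup>2" for a b
    proof -
      have "(cmod (a + b))\<^sup>2 \<le> (cmod a + cmod b)\<^sup>2"
        by (intro power_mono norm_triangle_ineq) auto
      also have "\<dots> \<le> 2 * (cmod a)\<^sup>2 + 2 * (cmod b)\<^sup>2"
        using sum_squares_bound[of "cmod a" "cmod b"] by (simp add: power2_sum)
      finally show ?thesis .
    qed
    then show "AE t in lborel. norm ((cmod (zext f t + zext g t))\<^sup>2)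
        \<le> norm (2 * (cmod (zext f t))\<^sup>2 + 2 * (cmod (zext g t))\<^sup>2)"
      by (intro AE_I2) (auto intro!: order_trans[OF _ abs_ge_self])
  qed measurable
qed

lemma L2_pos_scale:
  assumes "f \<in> L2_pos" shows "(\<lambda>t. c * f t) \<in> L2_pos"
proof (rule L2_posI; unfold zext_linear)
  note [measurable] = zext_measurable[OF assms(1)]
  show "(\<lambda>t. c * zext f t) \<in> borel_measurable borel" by measurable
  show "integrable lborel (\<lambda>t. (cmod (c * zext f t))\<^sup>2)"
    using zext_square_integrable[OF assms] by (simp add: norm_mult power_mult_distrib)
qed

lemma L2_pos_lincomb:
  assumes "\<And>i. i < n \<Longrightarrow> b i \<in> L2_pos" shows "lincomb n c b \<in> L2_pos"
  using assms
proof (induction n)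
  case (Suc n)
  then show ?case
    using L2_pos_add[OF Suc.IH L2_pos_scale[of "b n" "c n"]] by (simp add: lincomb_def)
qed (simp add: lincomb_def)

lemma laplace_add:
  assumes "f \<in> L2_pos" "g \<in> L2_pos" "x > 0"
  shows "laplace (\<lambda>t. f t + g t) x = laplace f x + laplace g x"
  using exp_zext_integrable[OF assms(1,3)] exp_zext_integrable[OF assms(2,3)]
  by (simp add: laplace_zext zext_linear scaleR_add_right)

lemma laplace_scale: "laplace (\<lambda>t. c * f t) x = c * laplace f x"
  by (simp add: laplace_zext zext_linear mult_scaleR_right[symmetric] del: mult_scaleR_right)

lemma laplace_lincomb:
  assumes "\<And>i. i < n \<Longrightarrow> b i \<in> L2_pos" "x > 0"
  shows "laplace (lincomb n c b) x = (\<Sum>i<n. c i * laplace (b i) x)"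
  using assms
proof (induction n)
  case 0
  then show ?case by (simp add: lincomb_def laplace_def)
next
  case (Suc n)
  then show ?case
    using laplace_add[OF L2_pos_lincomb[of n b c] L2_pos_scale[of "b n" "c n"] Suc.prems(2)]
    by (simp add: lincomb_def laplace_scale)
qed

text \<open>
  Only the existence of \<open>g\<close> is recorded: since the Laplace transform is linear, the images of
  finitely many functions can be combined afterwards (\<open>laplace_multiplier_family\<close>).
\<close>

definition laplace_multiplier :: "(real \<Rightarrow> real) \<Rightarrow> bool" where
  "laplace_multiplier m \<longleftrightarrow>
     (\<forall>f\<in>L2_pos. \<exists>g\<in>L2_pos. \<forall>x>0. laplace g x = of_real (m x) * laplace f x)"

lemma laplace_multiplier_const: "laplace_multiplier (\<lambda>x. c)"
  unfolding laplace_multiplier_def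
proof
  fix f assume "f \<in> L2_pos"
  then show "\<exists>g\<in>L2_pos. \<forall>x>0. laplace g x = of_real c * laplace f x"
    using L2_pos_scale[of f "of_real c"] laplace_scale[of "of_real c" f] by blast
qed

lemma laplace_multiplier_resolvent: "b > 0 \<Longrightarrow> laplace_multiplier (\<lambda>x. 1 / (x + b))"
  unfolding laplace_multiplier_def by (metis laplace_resolvent mult.commute of_real_1 of_real_divide times_divide_eq_right mult_1_right)

lemma laplace_multiplier_mult:
  assumes "laplace_multiplier m" "laplace_multiplier l"
  shows "laplace_multiplier (\<lambda>x. m x * l x)"
  unfolding laplace_multiplier_def
proof
  fix f assume f: "f \<in> L2_pos"
  obtain g where g: "g \<in> L2_pos" "\<forall>x>0. laplace g x = of_real (l x) * laplace f x"
    using assms(2) f unfolding laplace_multiplier_def by blast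
  obtain h where h: "h \<in> L2_pos" "\<forall>x>0. laplace h x = of_real (m x) * laplace g x"
    using assms(1) g(1) unfolding laplace_multiplier_def by blast
  show "\<exists>g\<in>L2_pos. \<forall>x>0. laplace g x = of_real (m x * l x) * laplace f x"
    using g h by (intro bexI[of _ h]) (auto simp: mult.assoc)
qed

lemma laplace_multiplier_add:
  assumes "laplace_multiplier m" "laplace_multiplier l"
  shows "laplace_multiplier (\<lambda>x. m x + l x)"
  unfolding laplace_multiplier_def
proof
  fix f assume f: "f \<in> L2_pos"
  obtain g where g: "g \<in> L2_pos" "\<forall>x>0. laplace g x = of_real (l x) * laplace f x"
    using assms(2) f unfolding laplace_multiplier_def by blast
  obtain h where h: "h \<in> L2_pos" "\<forall>x>0. laplace h x = of_real (m x) * laplace f x"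
    using assms(1) f unfolding laplace_multiplier_def by blast
  show "\<exists>g\<in>L2_pos. \<forall>x>0. laplace g x = of_real (m x + l x) * laplace f x"
    using g h L2_pos_add[OF h(1) g(1)]
    by (intro bexI[of _ "\<lambda>t. h t + g t"]) (auto simp: laplace_add algebra_simps)
qed

lemma laplace_multiplier_power:
  "laplace_multiplier m \<Longrightarrow> laplace_multiplier (\<lambda>x. m x ^ N)"
  by (induction N) (auto intro: laplace_multiplier_mult laplace_multiplier_const)

lemma laplace_multiplier_cong:
  "laplace_multiplier m \<Longrightarrow> (\<And>x. x > 0 \<Longrightarrow> m x = l x) \<Longrightarrow> laplace_multiplier l"
  unfolding laplace_multiplier_def by metis

section \<open>Negative subspaces and the dimension count\<close>

lemma sum_fun_eval: "(\<Sum>x\<in>A. f x) t = (\<Sum>x\<in>A. (f x :: real \<Rightarrow> complex) t)"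
  by (induction A rule: infinite_finite_induct) auto

text \<open>
  Negativity on all nontrivial combinations already forces the \<open>g i\<close> to be distinct and linearly
  independent, since the form is not negative at \<open>0\<close>.
\<close>

lemma N_minus_geI:
  assumes zero: "\<not> a (\<lambda>_. 0) < 0" "(\<lambda>_. 0) \<in> D"
    and neg: "\<And>c. \<exists>i<n. c i \<noteq> 0 \<Longrightarrow> lincomb n c g \<in> D \<and> a (lincomb n c g) < 0"
  shows "enat n \<le> N_minus D a"
proof -
  let ?B = "g ` {..<n}"
  have z: "c i = 0" if "lincomb n c g = (\<lambda>_. 0)" "i < n" for c i
    using neg[of c] that zero(1) by (metis)
  have inj: "inj_on g {..<n}"
  proof (rule inj_onI, rule ccontr)
    fix i j assume ij: "i \<in> {..<n}" "j \<in> {..<n}" "g i = g j" "i \<noteq> j"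
    define c :: "nat \<Rightarrow> complex" where "c k = (if k = i then 1 else 0) - (if k = j then 1 else 0)" for k
    have "lincomb n c g = (\<lambda>t. (\<Sum>k<n. if k = i then g k t else 0) - (\<Sum>k<n. if k = j then g k t else 0))"
      unfolding lincomb_def sum_subtractf[symmetric] by (intro ext sum.cong) (auto simp: c_def)
    then have "lincomb n c g = (\<lambda>_. 0)" using ij by simp
    from z[OF this, of i] ij show False by (simp add: c_def)
  qed
  have lc: "(\<Sum>v\<in>?B. (\<lambda>t. u v * v t)) = lincomb n (u \<circ> g) g" for u
    unfolding sum.reindex[OF inj] by (simp add: lincomb_def fun_eq_iff sum_fun_eval)
  have ind: "cfun.independent ?B"
  proof
    assume "cfun.dependent ?B"
    then obtain u where u: "\<exists>v\<in>?B. u v \<noteq> 0" "(\<Sum>v\<in>?B. (\<lambda>t. u v * v t)) = 0"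
      by (auto simp: cfun.dependent_finite)
    then have "\<exists>i<n. (u \<circ> g) i \<noteq> 0" by auto
    moreover have "lincomb n (u \<circ> g) g = (\<lambda>_. 0)" using u(2) lc by (simp add: zero_fun_def)
    ultimately show False using z by blast
  qed
  have sp: "f \<in> D \<and> (f \<noteq> 0 \<longrightarrow> a f < 0)" if "f \<in> cfun.span ?B" for f
  proof -
    obtain u where "f = (\<Sum>v\<in>?B. (\<lambda>t. u v * v t))"
      using \<open>f \<in> cfun.span ?B\<close> by (subst (asm) cfun.span_finite) auto
    then have f: "f = lincomb n (u \<circ> g) g" using lc by simp
    show ?thesis
    proof (cases "\<exists>i<n. (u \<circ> g) i \<noteq> 0")
      case True
      then show ?thesis using neg f by blast
    next
      case False
      then have "f = (\<lambda>_. 0)" unfolding f lincomb_def by auto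
      then show ?thesis using zero by (simp add: zero_fun_def)
    qed
  qed
  have "card ?B = n" using card_image[OF inj] by simp
  then show ?thesis
    unfolding N_minus_def using ind sp
    by (intro Sup_upper CollectI exI[of _ ?B]) auto
qed

lemma negative_subspace_enumeration:
  assumes B: "finite B" "cfun.independent B" "cfun.span B \<subseteq> D"
    and neg: "\<forall>f\<in>cfun.span B. f \<noteq> 0 \<longrightarrow> a f < 0"
  obtains b where "\<And>i. i < card B \<Longrightarrow> b i \<in> D"
    and "\<And>c. \<exists>i<card B. c i \<noteq> 0 \<Longrightarrow> a (lincomb (card B) c b) < 0"
proof -
  obtain b where b: "bij_betw b {..<card B} B"
    using ex_bij_betw_nat_finite[OF B(1)] by (auto simp: lessThan_atLeast0)
  show ?thesis
  proof
    show "b i \<in> D" if "i < card B" for i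
      using that b B(3) cfun.span_base[of "b i" B] by (auto simp: bij_betw_def)
    fix c :: "nat \<Rightarrow> complex" assume c: "\<exists>i<card B. c i \<noteq> 0"
    define u where "u = c \<circ> the_inv_into {..<card B} b"
    have ub: "u (b i) = c i" if "i < card B" for i
      using that b by (simp add: u_def the_inv_into_f_f bij_betw_def)
    have inj: "inj_on b {..<card B}" and im: "b ` {..<card B} = B" using b by (auto simp: bij_betw_def)
    have "(\<Sum>v\<in>B. (\<lambda>t. u v * v t)) = (\<Sum>v\<in>b ` {..<card B}. (\<lambda>t. u v * v t))"
      by (simp add: im)
    also have "\<dots> = lincomb (card B) c b"
      unfolding sum.reindex[OF inj] by (simp add: lincomb_def fun_eq_iff sum_fun_eval ub)
    finally have lc: "(\<Sum>v\<in>B. (\<lambda>t. u v * v t)) = lincomb (card B) c b" .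
    have "lincomb (card B) c b \<in> cfun.span B"
      unfolding lc[symmetric] by (intro cfun.span_sum cfun.span_scale cfun.span_base)
    moreover have "lincomb (card B) c b \<noteq> 0"
    proof
      assume "lincomb (card B) c b = 0"
      moreover obtain i where "i < card B" "c i \<noteq> 0" using c by blast
      ultimately have "cfun.dependent B"
        unfolding cfun.dependent_finite[OF B(1)] using lc ub im
        by (intro exI[of _ u] conjI bexI[of _ "b i"]) auto
      then show False using B(2) by simp
    qed
    ultimately show "a (lincomb (card B) c b) < 0" using neg by blast
  qed
qed

text \<open>
  A positive definite form on a finite-dimensional space attains a positive minimum on the unit
  sphere, which is compact. The sphere lives in \<open>nat \<Rightarrow> complex\<close> with the product topology, with all
  coordinates from \<open>n\<close> on equal to \<open>0\<close>.
\<close>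

lemma hermitian_form_lower_bound:
  fixes A :: "nat \<Rightarrow> nat \<Rightarrow> complex" and n :: nat
  defines "Q \<equiv> \<lambda>c :: nat \<Rightarrow> complex. Re (\<Sum>i<n. \<Sum>j<n. c i * cnj (c j) * A i j)"
  assumes pos: "\<And>c. \<exists>i<n. c i \<noteq> 0 \<Longrightarrow> Q c > 0"
  obtains \<kappa> where "\<kappa> > 0" "\<And>c. \<kappa> * (\<Sum>i<n. (cmod (c i))\<^sup>2) \<le> Q c"
proof (cases "n = 0")
  case True
  then show ?thesis using that[of 1] by (simp add: Q_def)
next
  case False
  have ev: "continuous_on X (\<lambda>c :: nat \<Rightarrow> complex. c i)" for X i
    by (rule continuous_on_product_then_coordinatewise) (rule continuous_on_id)
  define P where "P = PiE UNIV (\<lambda>i::nat. if i < n then cball (0::complex) 1 else {0})"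
  define K where "K = P \<inter> {c. (\<Sum>i<n. (cmod (c i))\<^sup>2) = 1}"
  have "compactin (product_topology (\<lambda>i. euclidean) UNIV) P"
    unfolding P_def by (subst compactin_PiE) auto
  then have "compact P"
    by (simp add: euclidean_product_topology)
  moreover have "closed {c :: nat \<Rightarrow> complex. (\<Sum>i<n. (cmod (c i))\<^sup>2) = 1}"
    by (intro closed_Collect_eq continuous_intros ev)
  ultimately have K: "compact K" unfolding K_def by (rule compact_Int_closed)
  have Kne: "(\<lambda>i. if i = 0 then 1 else 0) \<in> K"
  proof -
    have "(\<Sum>i<n. (cmod (if i = 0 then 1 else 0))\<^sup>2) = (\<Sum>i<n. if i = 0 then 1 else 0 :: real)"
      by (intro sum.cong) auto
    then show ?thesis using False by (auto simp: K_def P_def PiE_def extensional_def)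
  qed
  have "continuous_on K Q"
    unfolding Q_def by (intro continuous_intros ev)
  then obtain c0 where c0: "c0 \<in> K" "\<And>c. c \<in> K \<Longrightarrow> Q c0 \<le> Q c"
    using continuous_attains_inf[OF K] Kne by blast
  have "\<exists>i<n. c0 i \<noteq> 0"
  proof (rule ccontr)
    assume "\<not> (\<exists>i<n. c0 i \<noteq> 0)"
    then have "(\<Sum>i<n. (cmod (c0 i))\<^sup>2) = 0" by simp
    then show False using c0(1) by (simp add: K_def)
  qed
  then have pos0: "Q c0 > 0" by (rule pos)
  show ?thesis
  proof (rule that[OF pos0])
    fix c :: "nat \<Rightarrow> complex"
    define S where "S = (\<Sum>i<n. (cmod (c i))\<^sup>2)"
    show "Q c0 * (\<Sum>i<n. (cmod (c i))\<^sup>2) \<le> Q c"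
    proof (cases "S = 0")
      case True
      then have "\<forall>i<n. c i = 0" by (auto simp: S_def sum_nonneg_eq_0_iff)
      then show ?thesis by (simp add: Q_def)
    next
      case False
      then have S: "S > 0" unfolding S_def by (simp add: less_le sum_nonneg)
      define d where "d i = (if i < n then c i / of_real (sqrt S) else 0)" for i
      have dS: "(\<Sum>i<n. (cmod (d i))\<^sup>2) = 1"
        using S by (simp add: d_def norm_divide power_divide real_sqrt_pow2 flip: sum_divide_distrib S_def)
      have "cmod (d i) \<le> 1" if "i < n" for i
      proof -
        have "(cmod (d i))\<^sup>2 \<le> (\<Sum>i<n. (cmod (d i))\<^sup>2)"
          using that by (intro member_le_sum) auto
        then show ?thesis using dS by (simp add: power_le_one_iff abs_square_le_1)
      qed
      then have "d \<in> K" using dS by (auto simp: K_def P_def PiE_def extensional_def d_def)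
      then have "Q c0 \<le> Q d" by (rule c0(2))
      also have "Q d = Q c / S"
      proof -
        have "(\<Sum>i<n. \<Sum>j<n. d i * cnj (d j) * A i j)
            = (\<Sum>i<n. \<Sum>j<n. c i * cnj (c j) * A i j / of_real S)"
        proof (intro sum.cong refl)
          fix i j assume ij: "i \<in> {..<n}" "j \<in> {..<n}"
          have "of_real (sqrt S) * of_real (sqrt S) = (of_real S :: complex)"
            using S by (simp flip: of_real_mult)
          then show "d i * cnj (d j) * A i j = c i * cnj (c j) * A i j / of_real S"
            using ij by (simp add: d_def)
        qed
        then show ?thesis unfolding Q_def by (simp only: sum_divide_distrib[symmetric] Re_divide_of_real)
      qed
      finally show ?thesis using S by (simp add: field_simps S_def)
    qed
  qed
qed

section \<open>Hankel forms as double integrals\<close>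

text \<open>
  For such kernels the double integral of the Hankel form converges absolutely on all of \<open>L\<^sup>2\<close>, so
  that the form can be computed by superposition of kernels.
\<close>

definition exp_bounded :: "(real \<Rightarrow> real) \<Rightarrow> bool" where
  "exp_bounded \<kappa> \<longleftrightarrow> \<kappa> \<in> borel_measurable borel \<and>
     (\<exists>C \<gamma>. \<gamma> > 0 \<and> (\<forall>u>0. \<bar>\<kappa> u\<bar> \<le> C * exp (- (\<gamma> * u))))"

lemma exp_boundedI:
  "\<kappa> \<in> borel_measurable borel \<Longrightarrow> \<gamma> > 0 \<Longrightarrow> (\<And>u. u > 0 \<Longrightarrow> \<bar>\<kappa> u\<bar> \<le> C * exp (- (\<gamma> * u))) \<Longrightarrow> exp_bounded \<kappa>"
  unfolding exp_bounded_def by blast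

lemma cnj_measurable [measurable]: "cnj \<in> borel_measurable borel"
  by (intro borel_measurable_continuous_onI continuous_intros)

text \<open>
  The density against which a Hankel kernel \<open>\<kappa> (t + s)\<close> is integrated. The kernels are
  real and the form is the real part of an inner product, hence the real part here.
\<close>

definition autocorr :: "(real \<Rightarrow> complex) \<Rightarrow> real \<times> real \<Rightarrow> real" where
  "autocorr f = (\<lambda>(t, s). Re (zext f s * cnj (zext f t)))"

lemma autocorr_measurable [measurable]:
  assumes "f \<in> L2_pos" shows "autocorr f \<in> borel_measurable (lborel \<Otimes>\<^sub>M lborel)"
proof -
  note [measurable] = zext_measurable[OF assms]
  show ?thesis unfolding autocorr_def by measurable
qed

lemma autocorr_eq_0: "t \<le> 0 \<or> s \<le> 0 \<Longrightarrow> autocorr f (t, s) = 0"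
  by (auto simp: autocorr_def)

lemma inner_hankel_eq:
  assumes f: "f \<in> L2_pos" and g: "g \<in> L2_pos" and \<kappa>: "exp_bounded \<kappa>"
  defines "h \<equiv> \<lambda>p. of_real (\<kappa> (fst p + snd p)) * zext f (snd p) * cnj (zext g (fst p))"
  shows "integrable (lborel \<Otimes>\<^sub>M lborel) h"
    and "inner_pos (hankel \<kappa> f) g = integral\<^sup>L (lborel \<Otimes>\<^sub>M lborel) h"
proof -
  note [measurable] = zext_measurable[OF f] zext_measurable[OF g]
  have [measurable]: "\<kappa> \<in> borel_measurable borel" using \<kappa> by (simp add: exp_bounded_def)
  obtain C \<gamma> where C: "\<gamma> > 0" "\<And>u. u > 0 \<Longrightarrow> \<bar>\<kappa> u\<bar> \<le> C * exp (- (\<gamma> * u))"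
    using \<kappa> unfolding exp_bounded_def by blast
  let ?e = "\<lambda>f t. cmod (exp (- (t * \<gamma>)) *\<^sub>R zext f t)"
  have ie: "integrable lborel (?e f)" "integrable lborel (?e g)"
    by (rule integrable_norm[OF exp_zext_integrable[OF f C(1)]], rule integrable_norm[OF exp_zext_integrable[OF g C(1)]])
  have iee: "integrable (lborel \<Otimes>\<^sub>M lborel) (\<lambda>(t, s). C * (?e g t * ?e f s))"
    by (rule lborel_pair.Fubini_integrable)
       (use ie in \<open>simp_all add: abs_mult del: norm_scaleR, measurable\<close>)
  have hm [measurable]: "h \<in> borel_measurable (lborel \<Otimes>\<^sub>M lborel)" unfolding h_def by measurable
  show ih: "integrable (lborel \<Otimes>\<^sub>M lborel) h"
  proof (rule Bochner_Integration.integrable_bound[OF iee])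
    have "norm (h (t, s)) \<le> C * (?e g t * ?e f s)" for t s
    proof (cases "t > 0 \<and> s > 0")
      case True
      then have "\<bar>\<kappa> (t + s)\<bar> * (cmod (f s) * cmod (g t)) \<le> C * exp (- (\<gamma> * (t + s))) * (cmod (f s) * cmod (g t))"
        using C(2)[of "t + s"] by (intro mult_right_mono) auto
      also have "exp (- (\<gamma> * (t + s))) = exp (- (t * \<gamma>)) * exp (- (s * \<gamma>))"
        by (simp add: algebra_simps flip: exp_add)
      finally show ?thesis using True by (simp add: h_def norm_mult algebra_simps)
    next
      case False
      then show ?thesis by (cases "t > 0") (auto simp: h_def)
    qed
    then show "AE p in lborel \<Otimes>\<^sub>M lborel. norm (h p) \<le> norm (case p of (t, s) \<Rightarrow> C * (?e g t * ?e f s))"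
      by (intro AE_I2) (auto intro: order_trans[OF _ abs_ge_self] split: prod.split)
  qed measurable
  have "inner_pos (hankel \<kappa> f) g = (LINT t|lborel. LINT s|lborel. h (t, s))"
  proof -
    have "indicator {0<..} t *\<^sub>R (hankel \<kappa> f t * cnj (g t)) = (LINT s|lborel. h (t, s))" for t
    proof -
      have "hankel \<kappa> f t = (LINT s|lborel. of_real (\<kappa> (t + s)) * zext f s)"
        unfolding hankel_def set_lebesgue_integral_def zext_def
        by (intro Bochner_Integration.integral_cong) auto
      then show ?thesis by (cases "t > 0") (auto simp: h_def)
    qed
    then show ?thesis
      unfolding inner_pos_def set_lebesgue_integral_def by simp
  qed
  then show "inner_pos (hankel \<kappa> f) g = integral\<^sup>L (lborel \<Otimes>\<^sub>M lborel) h"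
    using lborel_pair.integral_fst'[OF ih] by simp
qed

lemma hankel_form_eq:
  assumes f: "f \<in> L2_pos" and \<kappa>: "exp_bounded \<kappa>"
  shows "integrable (lborel \<Otimes>\<^sub>M lborel) (\<lambda>p. \<kappa> (fst p + snd p) * autocorr f p)"
    and "hankel_form \<kappa> f = (LINT p|(lborel \<Otimes>\<^sub>M lborel). \<kappa> (fst p + snd p) * autocorr f p)"
proof -
  note h = inner_hankel_eq[OF f f \<kappa>]
  have Re_h: "Re (of_real (\<kappa> (fst p + snd p)) * zext f (snd p) * cnj (zext f (fst p)))
      = \<kappa> (fst p + snd p) * autocorr f p" for p
    by (cases p) (simp add: autocorr_def mult.assoc algebra_simps)
  show "integrable (lborel \<Otimes>\<^sub>M lborel) (\<lambda>p. \<kappa> (fst p + snd p) * autocorr f p)"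
    using integrable_Re[OF h(1)] unfolding Re_h .
  show "hankel_form \<kappa> f = (LINT p|(lborel \<Otimes>\<^sub>M lborel). \<kappa> (fst p + snd p) * autocorr f p)"
    unfolding hankel_form_def h(2) integral_Re[OF h(1), symmetric] Re_h ..
qed

lemma hankel_form_lincomb:
  assumes b: "\<And>i. i < n \<Longrightarrow> b i \<in> L2_pos" and \<kappa>: "exp_bounded \<kappa>"
  shows "hankel_form \<kappa> (lincomb n c b)
    = Re (\<Sum>i<n. \<Sum>j<n. c i * cnj (c j) * inner_pos (hankel \<kappa> (b i)) (b j))"
proof -
  let ?M = "lborel \<Otimes>\<^sub>M lborel :: (real \<times> real) measure"
  let ?h = "\<lambda>f g p. of_real (\<kappa> (fst p + snd p)) * zext f (snd p) * cnj (zext g (fst p))"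
  have L: "lincomb n c b \<in> L2_pos" by (rule L2_pos_lincomb[OF b])
  have z: "zext (lincomb n c b) t = (\<Sum>i<n. c i * zext (b i) t)" for t
    by (simp add: zext_def lincomb_def scaleR_sum_right)
  have "?h (lincomb n c b) (lincomb n c b) p = (\<Sum>i<n. \<Sum>j<n. c i * cnj (c j) * ?h (b i) (b j) p)" for p
  proof -
    have "?h (lincomb n c b) (lincomb n c b) p = of_real (\<kappa> (fst p + snd p)) *
        ((\<Sum>i<n. c i * zext (b i) (snd p)) * (\<Sum>j<n. cnj (c j) * cnj (zext (b j) (fst p))))"
      by (simp add: z mult.assoc)
    also have "\<dots> = (\<Sum>i<n. \<Sum>j<n. c i * cnj (c j) * ?h (b i) (b j) p)"
      unfolding sum_product unfolding sum_distrib_left by (intro sum.cong refl) (simp add: mult_ac)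
    finally show ?thesis .
  qed
  then have "inner_pos (hankel \<kappa> (lincomb n c b)) (lincomb n c b)
      = (LINT p|?M. (\<Sum>i<n. \<Sum>j<n. c i * cnj (c j) * ?h (b i) (b j) p))"
    unfolding inner_hankel_eq(2)[OF L L \<kappa>] by (simp only:)
  also have "\<dots> = (\<Sum>i<n. LINT p|?M. (\<Sum>j<n. c i * cnj (c j) * ?h (b i) (b j) p))"
    by (rule Bochner_Integration.integral_sum)
       (intro Bochner_Integration.integrable_sum integrable_mult_right inner_hankel_eq(1)[OF b b \<kappa>]; simp)
  also have "\<dots> = (\<Sum>i<n. \<Sum>j<n. c i * cnj (c j) * (LINT p|?M. ?h (b i) (b j) p))"
  proof (rule sum.cong[OF refl])
    fix i assume i: "i \<in> {..<n}"
    have "(LINT p|?M. (\<Sum>j<n. c i * cnj (c j) * ?h (b i) (b j) p))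
        = (\<Sum>j<n. LINT p|?M. c i * cnj (c j) * ?h (b i) (b j) p)"
      by (rule Bochner_Integration.integral_sum)
         (intro integrable_mult_right inner_hankel_eq(1)[OF b b \<kappa>]; use i in simp)
    then show "(LINT p|?M. (\<Sum>j<n. c i * cnj (c j) * ?h (b i) (b j) p))
        = (\<Sum>j<n. c i * cnj (c j) * (LINT p|?M. ?h (b i) (b j) p))"
      by (simp only: integral_mult_right_zero)
  qed
  also have "\<dots> = (\<Sum>i<n. \<Sum>j<n. c i * cnj (c j) * inner_pos (hankel \<kappa> (b i)) (b j))"
    by (intro sum.cong refl) (simp add: inner_hankel_eq(2)[OF b b \<kappa>])
  finally show ?thesis by (simp only: hankel_form_def)
qed

lemma hankel_form_cong:
  assumes "f \<in> L2_pos" "exp_bounded \<kappa>" "exp_bounded \<eta>" "\<And>u. u > 0 \<Longrightarrow> \<kappa> u = \<eta> u"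
  shows "hankel_form \<kappa> f = hankel_form \<eta> f"
proof -
  have "\<kappa> (fst p + snd p) * autocorr f p = \<eta> (fst p + snd p) * autocorr f p" for p
    using assms(4)[of "fst p + snd p"] autocorr_eq_0[of "fst p" "snd p" f] by fastforce
  then show ?thesis using hankel_form_eq(2) assms(1-3) by (simp only:)
qed

lemma hankel_form_zero: "hankel_form \<kappa> (\<lambda>_. 0) = 0"
  by (simp add: hankel_form_def inner_pos_def)

lemma hankel_form_scale:
  "hankel_form (\<lambda>u. a * \<kappa> u) f = a * hankel_form \<kappa> f"
proof -
  have "hankel (\<lambda>u. a * \<kappa> u) f t = of_real a * hankel \<kappa> f t" for t
    by (simp add: hankel_def mult.assoc)
  then show ?thesis by (simp add: hankel_form_def inner_pos_def mult.assoc)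
qed

lemma exp_bounded_add:
  assumes "exp_bounded \<kappa>" "exp_bounded \<eta>" shows "exp_bounded (\<lambda>u. \<kappa> u + \<eta> u)"
proof -
  obtain C \<gamma> where C: "\<gamma> > 0" "\<And>u. u > 0 \<Longrightarrow> \<bar>\<kappa> u\<bar> \<le> C * exp (- (\<gamma> * u))"
    using assms(1) unfolding exp_bounded_def by blast
  obtain D \<delta> where D: "\<delta> > 0" "\<And>u. u > 0 \<Longrightarrow> \<bar>\<eta> u\<bar> \<le> D * exp (- (\<delta> * u))"
    using assms(2) unfolding exp_bounded_def by blast
  have [measurable]: "\<kappa> \<in> borel_measurable borel" "\<eta> \<in> borel_measurable borel"
    using assms by (auto simp: exp_bounded_def)
  show ?thesis
  proof (rule exp_boundedI[where \<gamma>="min \<gamma> \<delta>" and C="\<bar>C\<bar> + \<bar>D\<bar>"])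
    fix u :: real assume u: "u > 0"
    have "\<bar>\<kappa> u\<bar> \<le> \<bar>C\<bar> * exp (- (min \<gamma> \<delta> * u))"
      using u by (intro order_trans[OF C(2)[OF u]] mult_mono) auto
    moreover have "\<bar>\<eta> u\<bar> \<le> \<bar>D\<bar> * exp (- (min \<gamma> \<delta> * u))"
      using u by (intro order_trans[OF D(2)[OF u]] mult_mono) auto
    ultimately show "\<bar>\<kappa> u + \<eta> u\<bar> \<le> (\<bar>C\<bar> + \<bar>D\<bar>) * exp (- (min \<gamma> \<delta> * u))"
      using abs_triangle_ineq[of "\<kappa> u" "\<eta> u"] by (simp only: distrib_right)
  qed (use C D in auto)
qed

lemma exp_bounded_scale:
  assumes "exp_bounded \<kappa>" shows "exp_bounded (\<lambda>u. a * \<kappa> u)"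
proof -
  obtain C \<gamma> where C: "\<gamma> > 0" "\<And>u. u > 0 \<Longrightarrow> \<bar>\<kappa> u\<bar> \<le> C * exp (- (\<gamma> * u))"
    using assms(1) unfolding exp_bounded_def by blast
  have [measurable]: "\<kappa> \<in> borel_measurable borel"
    using assms by (auto simp: exp_bounded_def)
  show ?thesis
    by (rule exp_boundedI[where \<gamma>=\<gamma> and C="\<bar>a\<bar> * C"])
       (use C in \<open>auto simp: abs_mult mult.assoc intro!: mult_left_mono\<close>)
qed

lemma hankel_form_add:
  assumes "f \<in> L2_pos" "exp_bounded \<kappa>" "exp_bounded \<eta>"
  shows "hankel_form (\<lambda>u. \<kappa> u + \<eta> u) f = hankel_form \<kappa> f + hankel_form \<eta> f"
  using hankel_form_eq[OF assms(1,2)] hankel_form_eq[OF assms(1,3)]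
    hankel_form_eq[OF assms(1) exp_bounded_add[OF assms(2,3)]]
  by (simp add: distrib_right)

lemma exp_bounded_zero: "exp_bounded (\<lambda>_. 0)"
  by (rule exp_boundedI[where \<gamma>=1 and C=0]) auto

lemma hankel_form_sum:
  fixes n :: nat
  assumes "f \<in> L2_pos" "\<And>j. exp_bounded (\<kappa> j)"
  shows "exp_bounded (\<lambda>u. \<Sum>j<n. a j * \<kappa> j u)"
    and "hankel_form (\<lambda>u. \<Sum>j<n. a j * \<kappa> j u) f = (\<Sum>j<n. a j * hankel_form (\<kappa> j) f)"
proof -
  have "exp_bounded (\<lambda>u. \<Sum>j<n. a j * \<kappa> j u) \<and>
    hankel_form (\<lambda>u. \<Sum>j<n. a j * \<kappa> j u) f = (\<Sum>j<n. a j * hankel_form (\<kappa> j) f)"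
  proof (induction n)
    case 0
    then show ?case using hankel_form_scale[of 0 "\<lambda>_. 0"] by (simp add: exp_bounded_zero)
  next
    case (Suc n)
    then show ?case
      using hankel_form_add[OF assms(1) conjunct1[OF Suc] exp_bounded_scale[OF assms(2)]]
        exp_bounded_add[OF conjunct1[OF Suc] exp_bounded_scale[OF assms(2)]]
      by (simp add: hankel_form_scale)
  qed
  then show "exp_bounded (\<lambda>u. \<Sum>j<n. a j * \<kappa> j u)"
    "hankel_form (\<lambda>u. \<Sum>j<n. a j * \<kappa> j u) f = (\<Sum>j<n. a j * hankel_form (\<kappa> j) f)" by auto
qed

text \<open>
  Half of the exponential decay is given up to absorb the power, by \<open>ln y \<le> y - 1\<close> applied to a
  small multiple of \<open>u + \<rho>\<close>.
\<close>

lemma exp_bounded_V_kernel: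
  assumes "\<rho> \<ge> 0" "\<beta> > 0" "k \<ge> 0"
  shows "exp_bounded (V_kernel v \<rho> k \<beta>)"
proof -
  have "exp_bounded (\<lambda>u. (u + \<rho>) powr k * exp (- (\<beta> * u)))"
  proof (cases "k = 0")
    case True
    show ?thesis
      by (rule exp_boundedI[where \<gamma>=\<beta> and C=1]) (use True assms in auto)
  next
    case False
    define \<epsilon> where "\<epsilon> = \<beta> / (2 * k)"
    have k: "k > 0" and \<epsilon>: "\<epsilon> > 0" using False assms by (auto simp: \<epsilon>_def)
    show ?thesis
    proof (rule exp_boundedI[where \<gamma>="\<beta>/2" and C="exp (\<beta> / 2 * \<rho> - k - k * ln \<epsilon>)"])
      fix u :: real assume u: "u > 0"
      define y where "y = u + \<rho>"
      have y: "y > 0" using u assms by (simp add: y_def)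
      have "k * (ln \<epsilon> + ln y) \<le> k * (\<epsilon> * y - 1)"
        using ln_le_minus_one[of "\<epsilon> * y"] y \<epsilon> k by (intro mult_left_mono) (auto simp: ln_mult)
      have "k * ln y \<le> \<beta> / 2 * y - k - k * ln \<epsilon>"
      proof -
        have "k * \<epsilon> = \<beta> / 2" using k by (simp add: \<epsilon>_def)
        moreover have "k * (\<epsilon> * y - 1) = (k * \<epsilon>) * y - k" by (simp add: algebra_simps)
        ultimately show ?thesis using \<open>k * (ln \<epsilon> + ln y) \<le> _\<close>
          by (simp only: distrib_left)
      qed
      then have "y powr k \<le> exp (\<beta> / 2 * y - k - k * ln \<epsilon>)"
        using y by (simp add: powr_def)
      then have "y powr k * exp (- (\<beta> * u)) \<le> exp (\<beta> / 2 * y - k - k * ln \<epsilon>) * exp (- (\<beta> * u))"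
        by (intro mult_right_mono) auto
      also have "\<dots> = exp (\<beta> / 2 * \<rho> - k - k * ln \<epsilon>) * exp (- (\<beta> / 2 * u))"
        by (simp add: y_def field_simps flip: exp_add)
      finally show "\<bar>(u + \<rho>) powr k * exp (- (\<beta> * u))\<bar> \<le> exp (\<beta> / 2 * \<rho> - k - k * ln \<epsilon>) * exp (- (\<beta> / 2 * u))"
        by (simp add: y_def)
    qed (use assms in auto)
  qed
  from exp_bounded_scale[OF this, of v] show ?thesis
    unfolding V_kernel_def[abs_def] by (simp add: mult.assoc)
qed

lemma exp_bounded_exp: "x > 0 \<Longrightarrow> exp_bounded (\<lambda>u. exp (- (x * u)))"
  by (rule exp_boundedI[where \<gamma>=x and C=1]) auto

text \<open>
  Exponential kernels factorize, which is the link between Hankel forms and Laplace transforms.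
\<close>

lemma hankel_form_exp: "hankel_form (\<lambda>u. exp (- (x * u))) f = (cmod (laplace f x))\<^sup>2"
proof -
  have h: "hankel (\<lambda>u. exp (- (x * u))) f t = of_real (exp (- (t * x))) * laplace f x" for t
  proof -
    have "hankel (\<lambda>u. exp (- (x * u))) f t
        = (LINT s:{0<..}|lborel. of_real (exp (- (t * x))) * (of_real (exp (- (s * x))) * f s))"
    proof -
      have "exp (- (x * (t + s))) = exp (- (t * x)) * exp (- (s * x))" for s
        by (simp add: algebra_simps flip: exp_add)
      then show ?thesis unfolding hankel_def by (simp add: mult.assoc)
    qed
    also have "\<dots> = of_real (exp (- (t * x))) * laplace f x"
      unfolding laplace_def by (subst set_integral_mult_right) simp
    finally show ?thesis .
  qed
  have "inner_pos (hankel (\<lambda>u. exp (- (x * u))) f) f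
      = (LINT t:{0<..}|lborel. laplace f x * cnj (of_real (exp (- (t * x))) * f t))"
    unfolding inner_pos_def h by (simp add: mult_ac)
  also have "\<dots> = laplace f x * cnj (laplace f x)"
  proof -
    have "indicator {0<..} t *\<^sub>R (laplace f x * cnj (of_real (exp (- (t * x))) * f t))
        = laplace f x * cnj (exp (- (t * x)) *\<^sub>R zext f t)" for t
      by (auto simp: zext_def indicator_def scaleR_conv_of_real)
    then have "(LINT t:{0<..}|lborel. laplace f x * cnj (of_real (exp (- (t * x))) * f t))
        = laplace f x * (LINT t|lborel. cnj (exp (- (t * x)) *\<^sub>R zext f t))"
      unfolding set_lebesgue_integral_def by (simp only: integral_mult_right_zero)
    then show ?thesis by (simp only: Bochner_Integration.integral_cnj laplace_zext)
  qed
  finally show ?thesis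
    by (simp add: hankel_form_def complex_mult_cnj cmod_power2)
qed

section \<open>Taylor remainders and kernels with a fractional power\<close>

text \<open>
  The remainder of the Taylor expansion of \<open>e\<^sup>-\<^sup>y\<close>, with the sign that makes it positive.
\<close>

definition exp_rem :: "nat \<Rightarrow> real \<Rightarrow> real" where
  "exp_rem n y = (-1) ^ n * (exp (- y) - (\<Sum>j<n. (- y) ^ j / fact j))"

lemma exp_rem_measurable [measurable]: "exp_rem n \<in> borel_measurable borel"
  unfolding exp_rem_def by measurable

lemma exp_rem_pos: assumes "y > 0" shows "exp_rem n y > 0"
proof -
  obtain t where "exp (- y) = (\<Sum>m<n. ((- y) ^ m) / fact m) + (exp t / fact n) * (- y) ^ n"
    using Maclaurin_exp_le[of "- y" n] by blast
  then have "exp_rem n y = (-1) ^ n * (exp t / fact n * (- y) ^ n)"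
    by (simp add: exp_rem_def)
  also have "\<dots> = exp t / fact n * ((-1) ^ n * (- y) ^ n)" by simp
  also have "(-1) ^ n * (- y) ^ n = y ^ n" by (simp flip: power_mult_distrib)
  finally have "exp_rem n y = exp t / fact n * y ^ n" .
  then show ?thesis using assms by simp
qed

lemma exp_rem_Suc: "exp_rem (Suc n) y = y ^ n / fact n - exp_rem n y"
proof -
  have "(-1) ^ n * (- y) ^ n = y ^ n" by (simp flip: power_mult_distrib)
  then show ?thesis by (simp add: exp_rem_def field_simps)
qed

text \<open>
  Consecutive remainders are positive and add up to a term of the series, so each of them is at most
  that term. The first bound is good near \<open>0\<close>, the second one at infinity.
\<close>

lemma exp_rem_le:
  assumes "y > 0"
  shows "exp_rem n y \<le> y ^ n" "n > 0 \<Longrightarrow> exp_rem n y \<le> y ^ (n - 1)"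
proof -
  have fact_le: "y ^ m / fact m \<le> y ^ m" for m
    using assms fact_ge_1[of m, where 'a=real] by (simp add: divide_le_eq mult_le_cancel_left1)
  show "exp_rem n y \<le> y ^ n"
    using exp_rem_Suc[of n y] exp_rem_pos[OF assms, of "Suc n"] fact_le[of n] by linarith
  show "exp_rem n y \<le> y ^ (n - 1)" if "n > 0"
    using exp_rem_Suc[of "n - 1" y] exp_rem_pos[OF assms, of "n - 1"] fact_le[of "n - 1"] that by simp
qed

definition laplace_energy :: "real \<Rightarrow> real \<Rightarrow> (real \<Rightarrow> complex) \<Rightarrow> real \<Rightarrow> real" where
  "laplace_energy \<rho> \<beta> f x = exp (- (\<rho> * x)) * (cmod (laplace f (\<beta> + x)))\<^sup>2"

text \<open>
  The Taylor polynomial of \<open>laplace_energy\<close> at \<open>0\<close> of degree less than \<open>n\<close>: differentiating the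
  exponential kernel brings down powers of \<open>- (t + s + \<rho>)\<close>, so the derivatives are Hankel forms with
  integer \<open>k\<close>.
\<close>

definition energy_jet :: "real \<Rightarrow> real \<Rightarrow> nat \<Rightarrow> (real \<Rightarrow> complex) \<Rightarrow> real \<Rightarrow> real" where
  "energy_jet \<rho> \<beta> n f x = (\<Sum>j<n. (- x) ^ j / fact j * hankel_form (V_kernel 1 \<rho> (real j) \<beta>) f)"

lemma exp_rem_kernel:
  assumes "\<rho> \<ge> 0" "u > 0"
  shows "exp_rem n ((u + \<rho>) * x) * exp (- (\<beta> * u))
    = (-1) ^ n * (exp (- (\<rho> * x)) * exp (- ((\<beta> + x) * u))
        + (\<Sum>j<n. (- ((- x) ^ j / fact j)) * V_kernel 1 \<rho> (real j) \<beta> u))"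
proof -
  have "exp (- ((u + \<rho>) * x)) * exp (- (\<beta> * u)) = exp (- (\<rho> * x)) * exp (- ((\<beta> + x) * u))"
    by (simp add: algebra_simps flip: exp_add)
  moreover have "(\<Sum>j<n. (- ((u + \<rho>) * x)) ^ j / fact j) * exp (- (\<beta> * u))
      = (\<Sum>j<n. ((- x) ^ j / fact j) * V_kernel 1 \<rho> (real j) \<beta> u)"
    unfolding sum_distrib_right
  proof (intro sum.cong refl)
    fix j
    have "(- ((u + \<rho>) * x)) ^ j = (- x) ^ j * (u + \<rho>) ^ j"
      by (simp flip: power_mult_distrib add: mult.commute)
    then show "(- ((u + \<rho>) * x)) ^ j / fact j * exp (- (\<beta> * u))
        = (- x) ^ j / fact j * V_kernel 1 \<rho> (real j) \<beta> u"
      using assms by (simp add: V_kernel_def powr_realpow)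
  qed
  ultimately show ?thesis
    by (simp add: exp_rem_def algebra_simps sum_negf)
qed

lemma hankel_form_exp_rem:
  assumes f: "f \<in> L2_pos" and p: "\<rho> \<ge> 0" "\<beta> > 0" "x > 0"
  shows "exp_bounded (\<lambda>u. exp_rem n ((u + \<rho>) * x) * exp (- (\<beta> * u)))"
    and "hankel_form (\<lambda>u. exp_rem n ((u + \<rho>) * x) * exp (- (\<beta> * u))) f
       = (-1) ^ n * (laplace_energy \<rho> \<beta> f x - energy_jet \<rho> \<beta> n f x)"
proof -
  let ?\<kappa> = "\<lambda>u. exp_rem n ((u + \<rho>) * x) * exp (- (\<beta> * u))"
  let ?\<kappa>1 = "\<lambda>u. exp (- (\<rho> * x)) * exp (- ((\<beta> + x) * u))"
  let ?\<kappa>2 = "\<lambda>u. \<Sum>j<n. (- ((- x) ^ j / fact j)) * V_kernel 1 \<rho> (real j) \<beta> u"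
  have b1: "exp_bounded ?\<kappa>1"
    using p by (intro exp_bounded_scale exp_bounded_exp) simp
  have bV: "exp_bounded (V_kernel 1 \<rho> (real j) \<beta>)" for j
    using p by (intro exp_bounded_V_kernel) auto
  have b2: "exp_bounded ?\<kappa>2" using hankel_form_sum(1)[OF f bV] .
  have b12: "exp_bounded (\<lambda>u. (-1) ^ n * (?\<kappa>1 u + ?\<kappa>2 u))"
    by (intro exp_bounded_scale exp_bounded_add b1 b2)
  then show b: "exp_bounded ?\<kappa>"
    unfolding exp_bounded_def using exp_rem_kernel[OF p(1), of _ n x \<beta>] by auto
  have "hankel_form ?\<kappa> f = hankel_form (\<lambda>u. (-1) ^ n * (?\<kappa>1 u + ?\<kappa>2 u)) f"
    by (rule hankel_form_cong[OF f b b12 exp_rem_kernel[OF p(1)]])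
  also have "\<dots> = (-1) ^ n * (hankel_form ?\<kappa>1 f + hankel_form ?\<kappa>2 f)"
    unfolding hankel_form_scale hankel_form_add[OF f b1 b2] ..
  also have "hankel_form ?\<kappa>1 f = laplace_energy \<rho> \<beta> f x"
    unfolding hankel_form_scale hankel_form_exp laplace_energy_def ..
  also have "hankel_form ?\<kappa>2 f = - energy_jet \<rho> \<beta> n f x"
    unfolding hankel_form_sum(2)[OF f bV] energy_jet_def by (simp add: sum_negf)
  finally show "hankel_form ?\<kappa> f = (-1) ^ n * (laplace_energy \<rho> \<beta> f x - energy_jet \<rho> \<beta> n f x)"
    by simp
qed

lemma laplace_energy_expansion:
  assumes f: "f \<in> L2_pos" and p: "\<rho> \<ge> 0" "\<beta> > 0"
  obtains C where "\<And>x. x > 0 \<Longrightarrow> \<bar>laplace_energy \<rho> \<beta> f x - energy_jet \<rho> \<beta> n f x\<bar> \<le> C * x ^ n"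
proof
  let ?w = "\<lambda>p. V_kernel 1 \<rho> (real n) \<beta> (fst p + snd p) * autocorr f p"
  note w = hankel_form_eq[OF f exp_bounded_V_kernel[OF p, of "real n" 1]]
  fix x :: real assume x: "x > 0"
  let ?\<kappa> = "\<lambda>u. exp_rem n ((u + \<rho>) * x) * exp (- (\<beta> * u))"
  note h = hankel_form_exp_rem[OF f p x, of n]
  note k = hankel_form_eq[OF f h(1)]
  have le: "norm (?\<kappa> (fst p + snd p) * autocorr f p) \<le> x ^ n * norm (?w p)" for p
  proof (cases "fst p > 0 \<and> snd p > 0")
    case True
    define u where "u = fst p + snd p"
    have u: "u > 0" using True by (simp add: u_def)
    have pos: "(u + \<rho>) * x > 0" using u x p by simp
    have "\<bar>exp_rem n ((u + \<rho>) * x)\<bar> \<le> (u + \<rho>) ^ n * x ^ n"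
      using exp_rem_pos[OF pos, of n] exp_rem_le(1)[OF pos, of n]
      by (simp add: power_mult_distrib)
    then have "\<bar>exp_rem n ((u + \<rho>) * x)\<bar> * (exp (- (\<beta> * u)) * \<bar>autocorr f p\<bar>)
        \<le> (u + \<rho>) ^ n * x ^ n * (exp (- (\<beta> * u)) * \<bar>autocorr f p\<bar>)"
      by (intro mult_right_mono) auto
    then show ?thesis
      unfolding u_def[symmetric] using u p
      by (simp add: V_kernel_def powr_realpow abs_mult mult_ac)
  next
    case False
    then show ?thesis using autocorr_eq_0[of "fst p" "snd p" f] by auto
  qed
  have "\<bar>laplace_energy \<rho> \<beta> f x - energy_jet \<rho> \<beta> n f x\<bar> = \<bar>hankel_form ?\<kappa> f\<bar>"
    unfolding h(2) by (simp add: abs_mult)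
  also have "\<dots> \<le> (LINT p|(lborel \<Otimes>\<^sub>M lborel). norm (?\<kappa> (fst p + snd p) * autocorr f p))"
    unfolding k(2) real_norm_def[symmetric] by (rule integral_norm_bound)
  also have "\<dots> \<le> (LINT p|(lborel \<Otimes>\<^sub>M lborel). x ^ n * norm (?w p))"
    using w(1) k(1) le by (intro integral_mono) auto
  finally show "\<bar>laplace_energy \<rho> \<beta> f x - energy_jet \<rho> \<beta> n f x\<bar>
      \<le> (LINT p|(lborel \<Otimes>\<^sub>M lborel). norm (?w p)) * x ^ n"
    by (simp add: mult.commute)
qed

text \<open>
  The constant coefficient is the limit at \<open>0\<close>; after division by \<open>x\<close> the same argument applies to
  the next one.
\<close>

lemma coeffs_zero_if_small:
  fixes a :: "nat \<Rightarrow> real"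
  assumes "\<And>x. 0 < x \<Longrightarrow> x < 1 \<Longrightarrow> \<bar>\<Sum>j<n. a j * x ^ j\<bar> \<le> C * x ^ n" "j < n"
  shows "a j = 0"
  using assms
proof (induction n arbitrary: a j)
  case (Suc n)
  let ?P = "\<lambda>x. \<Sum>j<Suc n. a j * x ^ j"
  have lim: "(?P \<longlongrightarrow> ?P 0) (at_right 0)"
    by (intro tendsto_intros)
  have "((\<lambda>x. C * x ^ Suc n) \<longlongrightarrow> C * 0 ^ Suc n) (at_right 0)"
    by (intro tendsto_intros)
  moreover have "\<forall>\<^sub>F x in at_right 0. \<bar>?P x\<bar> \<le> C * x ^ Suc n"
    using Suc.prems(1) by (intro eventually_at_rightI[of 0 1]) auto
  ultimately have "(?P \<longlongrightarrow> 0) (at_right 0)"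
    by (intro Lim_null_comparison[of ?P "\<lambda>x. C * x ^ Suc n"]) auto
  then have "?P 0 = 0"
    using tendsto_unique[OF _ lim] by (simp add: trivial_limit_at_right_real)
  then have a0: "a 0 = 0" by (simp add: sum.lessThan_Suc_shift del: sum.lessThan_Suc)
  show ?case
  proof (cases j)
    case 0
    then show ?thesis using a0 by simp
  next
    case (Suc i)
    have "a (Suc i) = 0"
    proof (rule Suc.IH[of "\<lambda>j. a (Suc j)"])
      show "i < n" using Suc Suc.prems(2) by simp
      fix x :: real assume x: "0 < x" "x < 1"
      have "?P x = x * (\<Sum>j<n. a (Suc j) * x ^ j)"
        by (simp add: sum.lessThan_Suc_shift a0 sum_distrib_left mult_ac del: sum.lessThan_Suc)
      then have "x * \<bar>\<Sum>j<n. a (Suc j) * x ^ j\<bar> \<le> x * (C * x ^ n)"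
        using Suc.prems(1)[OF x] x by (simp add: abs_mult mult_ac del: sum.lessThan_Suc)
      then show "\<bar>\<Sum>j<n. a (Suc j) * x ^ j\<bar> \<le> C * x ^ n" using x by simp
    qed
    then show ?thesis using Suc by simp
  qed
qed simp

text \<open>
  Functions whose energies agree to order \<open>n\<close> at \<open>0\<close> have the same Taylor polynomial there. In
  particular, the forms with integer \<open>k < n\<close> cannot distinguish them.
\<close>

lemma energy_jet_eqI:
  assumes f: "f \<in> L2_pos" and g: "g \<in> L2_pos" and p: "\<rho> \<ge> 0" "\<beta> > 0"
    and close: "\<And>x. 0 < x \<Longrightarrow> x < 1 \<Longrightarrow> \<bar>laplace_energy \<rho> \<beta> f x - laplace_energy \<rho> \<beta> g x\<bar> \<le> C * x ^ n"
  shows "j < n \<Longrightarrow> hankel_form (V_kernel 1 \<rho> (real j) \<beta>) f = hankel_form (V_kernel 1 \<rho> (real j) \<beta>) g"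
    and "energy_jet \<rho> \<beta> n f = energy_jet \<rho> \<beta> n g"
proof -
  obtain F where F: "\<And>x. x > 0 \<Longrightarrow> \<bar>laplace_energy \<rho> \<beta> f x - energy_jet \<rho> \<beta> n f x\<bar> \<le> F * x ^ n"
    using laplace_energy_expansion[OF f p] by blast
  obtain G where G: "\<And>x. x > 0 \<Longrightarrow> \<bar>laplace_energy \<rho> \<beta> g x - energy_jet \<rho> \<beta> n g x\<bar> \<le> G * x ^ n"
    using laplace_energy_expansion[OF g p] by blast
  define S where "S j = hankel_form (V_kernel 1 \<rho> (real j) \<beta>) f - hankel_form (V_kernel 1 \<rho> (real j) \<beta>) g" for j
  have S: "(-1) ^ j / fact j * S j = 0" if "j < n" for j
  proof (rule coeffs_zero_if_small[OF _ that])
    fix x :: real assume x: "0 < x" "x < 1"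
    have "(- x) ^ j = (-1) ^ j * x ^ j" for j by (simp flip: power_mult_distrib)
    then have "(\<Sum>j<n. (-1) ^ j / fact j * S j * x ^ j) = energy_jet \<rho> \<beta> n f x - energy_jet \<rho> \<beta> n g x"
      unfolding energy_jet_def S_def sum_subtractf[symmetric]
      by (intro sum.cong refl) (simp add: field_simps)
    also have "\<bar>\<dots>\<bar> \<le> (F + G + C) * x ^ n"
      using F[OF x(1)] G[OF x(1)] close[OF x] by (simp add: distrib_right)
    finally show "\<bar>\<Sum>j<n. (-1) ^ j / fact j * S j * x ^ j\<bar> \<le> (F + G + C) * x ^ n" .
  qed
  then show *: "hankel_form (V_kernel 1 \<rho> (real j) \<beta>) f = hankel_form (V_kernel 1 \<rho> (real j) \<beta>) g" if "j < n" for j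
    using that by (auto simp: S_def)
  show "energy_jet \<rho> \<beta> n f = energy_jet \<rho> \<beta> n g"
    unfolding energy_jet_def by (intro ext sum.cong refl) (simp add: *)
qed

lemma integrable_lborel_powr:
  fixes e :: real
  shows "e > -1 \<Longrightarrow> integrable lborel (\<lambda>x. indicator {0<..1} x * x powr e)"
    and "e < -1 \<Longrightarrow> integrable lborel (\<lambda>x. indicator {1..} x * x powr e)"
proof -
  show "integrable lborel (\<lambda>x. indicator {0<..1} x * x powr e)" if "e > -1"
  proof -
    have "((\<lambda>x. x powr e) has_integral (1 powr (e+1) / (e+1))) {0<..1}"
      using has_integral_powr_from_0[OF that, of 1]
      by (subst has_integral_spike_set_eq[of "{0<..1}" "{0..1}"])
         (auto intro: negligible_subset[of "{0::real}"])
    then show ?thesis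
      using has_bochner_integral_of_nonneg_has_integral[of "\<lambda>x. x powr e" "{0<..1}"]
      by (auto simp: has_bochner_integral_iff)
  qed
  show "integrable lborel (\<lambda>x. indicator {1..} x * x powr e)" if "e < -1"
    using has_bochner_integral_of_nonneg_has_integral[OF _ _ _ has_integral_powr_to_inf[OF that, of 1]]
    by (auto simp: has_bochner_integral_iff)
qed

text \<open>
  Substituting \<open>x / u\<close> for \<open>x\<close> shows that the integral scales like \<open>u\<^sup>k\<close>. It converges since the
  remainder is of order \<open>x\<^sup>n\<close> at \<open>0\<close> and at most of order \<open>x\<^sup>n\<^sup>-\<^sup>1\<close> at infinity. The constant \<open>c\<close> is
  \<open>|\<Gamma>(-k)|\<close>.
\<close>

lemma powr_as_exp_rem_integral:
  assumes "real n - 1 < k" "k < real n" "k \<ge> 0"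
  obtains c where "c > 0"
    and "\<And>u. u > 0 \<Longrightarrow> has_bochner_integral lborel
          (\<lambda>x. indicator {0<..} x * (x powr (- k - 1) * exp_rem n (u * x))) (c * u powr k)"
proof -
  define \<phi> where "\<phi> x = indicator {0<..} x * (x powr (- k - 1) * exp_rem n x)" for x :: real
  have [measurable]: "\<phi> \<in> borel_measurable borel" unfolding \<phi>_def by measurable
  have n: "n > 0" using assms by (cases n) auto
  have nonneg: "\<phi> x \<ge> 0" for x
    using exp_rem_pos[of x n] by (simp add: \<phi>_def indicator_def less_imp_le)
  let ?d = "\<lambda>x. indicator {0<..1} x * x powr (real n - k - 1) + indicator {1..} x * x powr (real n - k - 2)"
  have int: "integrable lborel \<phi>"
  proof (rule Bochner_Integration.integrable_bound)
    show "integrable lborel ?d"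
      using assms by (intro Bochner_Integration.integrable_add integrable_lborel_powr) auto
    have "\<phi> x \<le> ?d x" for x
    proof (cases "x > 0")
      case True
      show ?thesis
      proof (cases "x \<le> 1")
        case le: True
        have "x powr (- k - 1) * exp_rem n x \<le> x powr (- k - 1) * x ^ n"
          using exp_rem_le(1)[OF True, of n] True by (intro mult_left_mono) auto
        also have "\<dots> = x powr (real n - k - 1)"
          using True by (simp add: powr_realpow[symmetric] algebra_simps flip: powr_add)
        finally show ?thesis using True le by (simp add: \<phi>_def add_increasing2)
      next
        case gt: False
        have "x powr (- k - 1) * exp_rem n x \<le> x powr (- k - 1) * x ^ (n - 1)"
          using exp_rem_le(2)[OF True n] True by (intro mult_left_mono) auto
        also have "\<dots> = x powr (real n - k - 2)"
          using True n by (simp add: powr_realpow[symmetric] of_nat_diff algebra_simps flip: powr_add)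
        finally show ?thesis using True gt by (simp add: \<phi>_def)
      qed
    qed (simp add: \<phi>_def)
    then show "AE x in lborel. norm (\<phi> x) \<le> norm (?d x)"
      using nonneg by (intro AE_I2) (auto intro: order_trans[OF _ abs_ge_self])
  qed measurable
  define c where "c = integral\<^sup>L lborel \<phi>"
  have "c \<ge> 0" unfolding c_def using nonneg by simp
  moreover have "c \<noteq> 0"
  proof
    assume "c = 0"
    then have "AE x in lborel. \<phi> x = 0"
      using integral_nonneg_eq_0_iff_AE[OF int] nonneg by (auto simp: c_def)
    then have "AE x in lborel. x \<notin> {0<..<1::real}"
    proof eventually_elim
      case (elim x)
      then show ?case using exp_rem_pos[of x n] by (auto simp: \<phi>_def)
    qed
    then have "emeasure lborel {0<..<1::real} = 0"
      by (subst (asm) AE_iff_measurable[of "{0<..<1}"]) auto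
    then show False by simp
  qed
  ultimately have c: "c > 0" by simp
  have hb: "has_bochner_integral lborel \<phi> c"
    using int by (simp add: has_bochner_integral_iff c_def)
  show ?thesis
  proof (rule that[OF c])
    fix u :: real assume u: "u > 0"
    have "has_bochner_integral lborel (\<lambda>x. \<phi> (u * x)) (c /\<^sub>R \<bar>u\<bar>)"
      using lborel_has_bochner_integral_real_affine_iff[of u \<phi> c 0] hb u by simp
    then have "has_bochner_integral lborel (\<lambda>x. u powr (k + 1) * \<phi> (u * x)) (u powr (k + 1) * (c /\<^sub>R \<bar>u\<bar>))"
      by (rule has_bochner_integral_mult_right)
    moreover have "u powr (k + 1) * (c /\<^sub>R \<bar>u\<bar>) = c * u powr k"
      using u by (simp add: powr_add)
    moreover have "u powr (k + 1) * \<phi> (u * x) = indicator {0<..} x * (x powr (- k - 1) * exp_rem n (u * x))" for x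
    proof (cases "x > 0")
      case True
      have "u powr (k + 1) * (u * x) powr (- k - 1) = x powr (- k - 1)"
        using True u powr_add[of u "k + 1" "- k - 1"] by (simp add: powr_mult)
      then show ?thesis using True u by (simp add: \<phi>_def mult.assoc[symmetric])
    next
      case False
      then have "\<not> u * x > 0" using u by (simp add: zero_less_mult_iff)
      then show ?thesis using False by (simp add: \<phi>_def)
    qed
    ultimately show "has_bochner_integral lborel
        (\<lambda>x. indicator {0<..} x * (x powr (- k - 1) * exp_rem n (u * x))) (c * u powr k)"
      by (simp only:)
  qed
qed

text \<open>
  The power in the kernel is written as an integral of Taylor remainders and the order of
  integration is exchanged. Positivity of the remainders gives absolute convergence.
\<close>

lemma hankel_form_fractional:
  assumes k: "real n - 1 < k" "k < real n" "k \<ge> 0" and p: "\<rho> \<ge> 0" "\<beta> > 0"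
  obtains c where "c > 0"
    and "\<And>f. f \<in> L2_pos \<Longrightarrow> integrable lborel
          (\<lambda>x. indicator {0<..} x * (x powr (- k - 1) * (laplace_energy \<rho> \<beta> f x - energy_jet \<rho> \<beta> n f x)))"
    and "\<And>f v. f \<in> L2_pos \<Longrightarrow> hankel_form (V_kernel v \<rho> k \<beta>) f = v * (-1) ^ n / c *
          (LINT x|lborel. indicator {0<..} x * (x powr (- k - 1) * (laplace_energy \<rho> \<beta> f x - energy_jet \<rho> \<beta> n f x)))"
proof -
  obtain c where c: "c > 0" and hb: "\<And>u. u > 0 \<Longrightarrow> has_bochner_integral lborel
          (\<lambda>x. indicator {0<..} x * (x powr (- k - 1) * exp_rem n (u * x))) (c * u powr k)"
    using powr_as_exp_rem_integral[OF k] by blast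
  let ?M = "lborel \<Otimes>\<^sub>M lborel :: (real \<times> real) measure"
  interpret P: pair_sigma_finite ?M lborel
    by (simp add: pair_sigma_finite_def lborel_prod sigma_finite_lborel)
  have main: "integrable lborel (\<lambda>x. indicator {0<..} x * (x powr (- k - 1) * (laplace_energy \<rho> \<beta> f x - energy_jet \<rho> \<beta> n f x)))
     \<and> c * hankel_form (V_kernel 1 \<rho> k \<beta>) f = (-1) ^ n *
          (LINT x|lborel. indicator {0<..} x * (x powr (- k - 1) * (laplace_energy \<rho> \<beta> f x - energy_jet \<rho> \<beta> n f x)))"
    if f: "f \<in> L2_pos" for f
  proof -
    note [measurable] = autocorr_measurable[OF f]
    define F where "F p x = indicator {0<..} x * (x powr (- k - 1) * exp_rem n ((fst p + snd p + \<rho>) * x))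
        * (exp (- (\<beta> * (fst p + snd p))) * autocorr f p)" for p and x :: real
    let ?V = "\<lambda>p. V_kernel 1 \<rho> k \<beta> (fst p + snd p) * autocorr f p"
    note V = hankel_form_eq[OF f exp_bounded_V_kernel[OF p k(3), of 1]]
    have Fhb: "has_bochner_integral lborel (F p) (c * ?V p)" for p
    proof (cases "fst p > 0 \<and> snd p > 0")
      case True
      then have "has_bochner_integral lborel (F p) (c * (fst p + snd p + \<rho>) powr k * (exp (- (\<beta> * (fst p + snd p))) * autocorr f p))"
        unfolding F_def using p by (intro has_bochner_integral_mult_left hb) simp
      then show ?thesis by (simp add: V_kernel_def mult_ac)
    next
      case False
      then have "autocorr f p = 0" using autocorr_eq_0[of "fst p" "snd p" f] by auto
      then show ?thesis by (simp add: F_def[abs_def] has_bochner_integral_zero)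
    qed
    have nF: "norm (F p x) = F p x * sgn (autocorr f p)" for p x
    proof (cases "fst p > 0 \<and> snd p > 0 \<and> x > 0")
      case True
      then have "exp_rem n ((fst p + snd p + \<rho>) * x) > 0"
        using p by (intro exp_rem_pos) simp
      then show ?thesis using True abs_sgn[of "autocorr f p"] by (simp add: F_def abs_mult)
    next
      case False
      then show ?thesis using autocorr_eq_0[of "fst p" "snd p" f] by (auto simp: F_def)
    qed
    have FI: "integrable (?M \<Otimes>\<^sub>M lborel) (\<lambda>(p, x). F p x)"
    proof (rule P.Fubini_integrable)
      show "(\<lambda>(p, x). F p x) \<in> borel_measurable (?M \<Otimes>\<^sub>M lborel)"
        unfolding F_def by measurable
      have "(LINT x|lborel. norm (F p x)) = c * norm (?V p)" for p
      proof -
        have "(LINT x|lborel. norm (F p x)) = c * ?V p * sgn (autocorr f p)"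
          unfolding nF using has_bochner_integral_integral_eq[OF Fhb[of p]] by simp
        then show ?thesis using abs_sgn[of "autocorr f p"] by (simp add: V_kernel_def abs_mult mult.assoc)
      qed
      then show "integrable ?M (\<lambda>p. LINT x|lborel. norm (case (p, x) of (p, x) \<Rightarrow> F p x))"
        using V(1) by simp
      show "AE p in ?M. integrable lborel (\<lambda>x. case (p, x) of (p, x) \<Rightarrow> F p x)"
        using Fhb by (auto simp: has_bochner_integral_iff)
    qed
    have inner: "(LINT p|?M. F p x) = (-1) ^ n *
        (indicator {0<..} x * (x powr (- k - 1) * (laplace_energy \<rho> \<beta> f x - energy_jet \<rho> \<beta> n f x)))" for x
    proof (cases "x > 0")
      case True
      note h = hankel_form_exp_rem[OF f p True, of n]
      have "(LINT p|?M. F p x) = (LINT p|?M. x powr (- k - 1) *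
          (exp_rem n ((fst p + snd p + \<rho>) * x) * exp (- (\<beta> * (fst p + snd p))) * autocorr f p))"
        unfolding F_def using True by (simp add: mult.assoc)
      also have "\<dots> = x powr (- k - 1) * ((-1) ^ n * (laplace_energy \<rho> \<beta> f x - energy_jet \<rho> \<beta> n f x))"
        by (simp only: integral_mult_right_zero hankel_form_eq(2)[OF f h(1), symmetric] h(2))
      finally show ?thesis using True by simp
    qed (simp add: F_def)
    have "integrable lborel (\<lambda>x. LINT p|?M. F p x)"
      using P.integrable_snd[OF FI] .
    then have "integrable lborel (\<lambda>x. (-1) ^ n * ((-1) ^ n *
        (indicator {0<..} x * (x powr (- k - 1) * (laplace_energy \<rho> \<beta> f x - energy_jet \<rho> \<beta> n f x)))))"
      unfolding inner by (rule integrable_mult_right)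
    then have i: "integrable lborel (\<lambda>x. indicator {0<..} x * (x powr (- k - 1) * (laplace_energy \<rho> \<beta> f x - energy_jet \<rho> \<beta> n f x)))"
      by (simp add: mult.assoc[symmetric] power_mult_distrib[symmetric])
    have "c * hankel_form (V_kernel 1 \<rho> k \<beta>) f = (LINT p|?M. LINT x|lborel. F p x)"
      unfolding has_bochner_integral_integral_eq[OF Fhb] V(2) by simp
    also have "\<dots> = (LINT x|lborel. LINT p|?M. F p x)"
      using P.Fubini_integral[OF FI] by simp
    finally show ?thesis using i unfolding inner by simp
  qed
  show ?thesis
  proof (rule that[OF c])
    show "integrable lborel
          (\<lambda>x. indicator {0<..} x * (x powr (- k - 1) * (laplace_energy \<rho> \<beta> f x - energy_jet \<rho> \<beta> n f x)))"
      if "f \<in> L2_pos" for f using main[OF that] by blast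
    fix f v assume "f \<in> L2_pos"
    have "hankel_form (V_kernel v \<rho> k \<beta>) f = v * hankel_form (V_kernel 1 \<rho> k \<beta>) f"
      using hankel_form_scale[of v "V_kernel 1 \<rho> k \<beta>" f] by (simp add: V_kernel_def[abs_def] mult.assoc)
    also have "\<dots> = v / c * (c * hankel_form (V_kernel 1 \<rho> k \<beta>) f)" using c by simp
    also have "\<dots> = v * (-1) ^ n / c *
          (LINT x|lborel. indicator {0<..} x * (x powr (- k - 1) * (laplace_energy \<rho> \<beta> f x - energy_jet \<rho> \<beta> n f x)))"
      using main[OF \<open>f \<in> L2_pos\<close>] by simp
    finally show "hankel_form (V_kernel v \<rho> k \<beta>) f = v * (-1) ^ n / c *
          (LINT x|lborel. indicator {0<..} x * (x powr (- k - 1) * (laplace_energy \<rho> \<beta> f x - energy_jet \<rho> \<beta> n f x)))" .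
  qed
qed

section \<open>Bumps and plateaus\<close>

definition bump :: "real \<Rightarrow> real \<Rightarrow> real" where
  "bump b x = 4 * b * x / (x + b)\<^sup>2"

lemma bump_measurable [measurable]: "bump b \<in> borel_measurable borel"
  unfolding bump_def by measurable

text \<open>
  With the Moebius coordinate \<open>z = (x - b) / (x + b)\<close> on \<open>(0, \<infinity>)\<close>, which vanishes at \<open>b\<close>, the bump is \<open>1 - z\<^sup>2\<close>.
\<close>

lemma bump_eq:
  assumes "b > 0" "x > 0"
  shows "bump b x = 1 - ((x - b) / (x + b))\<^sup>2"
proof -
  have "bump b x = ((x + b)\<^sup>2 - (x - b)\<^sup>2) / (x + b)\<^sup>2"
    by (simp add: bump_def power2_eq_square algebra_simps)
  also have "\<dots> = 1 - ((x - b) / (x + b))\<^sup>2"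
    unfolding power_divide unfolding diff_divide_distrib using assms by simp
  finally show ?thesis .
qed

lemma bump_pos: "b > 0 \<Longrightarrow> x > 0 \<Longrightarrow> bump b x > 0"
  by (simp add: bump_def)

lemma bump_le_1: "b > 0 \<Longrightarrow> x > 0 \<Longrightarrow> bump b x \<le> 1"
  by (simp add: bump_eq)

lemma bump_less_1: "b > 0 \<Longrightarrow> x > 0 \<Longrightarrow> x \<noteq> b \<Longrightarrow> bump b x < 1"
  by (simp add: bump_eq)

lemma bump_mono:
  assumes "b > 0" "x > 0" "y > 0" "(y - x) * (b\<^sup>2 - x * y) \<ge> 0"
  shows "bump b x \<le> bump b y"
proof -
  have "y * (x + b)\<^sup>2 - x * (y + b)\<^sup>2 = (y - x) * (b\<^sup>2 - x * y)"
    by (simp add: power2_eq_square algebra_simps)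
  then have "x * (y + b)\<^sup>2 \<le> y * (x + b)\<^sup>2" using assms(4) by linarith
  then show ?thesis
    using assms by (simp add: bump_def frac_le_eq divide_le_eq le_divide_eq mult_ac)
qed

lemma laplace_multiplier_bump:
  assumes "b > 0" shows "laplace_multiplier (bump b)"
proof (rule laplace_multiplier_cong)
  show "laplace_multiplier (\<lambda>x. (4 * b) * (1 / (x + b) * (1 + (- b) * (1 / (x + b)))))"
    using assms by (intro laplace_multiplier_mult laplace_multiplier_add laplace_multiplier_const
        laplace_multiplier_resolvent)
  show "4 * b * (1 / (x + b) * (1 + (- b) * (1 / (x + b)))) = bump b x" if "x > 0" for x
    using that assms by (simp add: bump_def power2_eq_square field_simps)
qed

lemma laplace_multiplier_mobius:
  assumes "b > 0" shows "laplace_multiplier (\<lambda>x. (x - b) / (x + b))"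
proof (rule laplace_multiplier_cong)
  show "laplace_multiplier (\<lambda>x. 1 + (- (2 * b)) * (1 / (x + b)))"
    using assms by (intro laplace_multiplier_mult laplace_multiplier_add laplace_multiplier_const
        laplace_multiplier_resolvent)
  show "1 + (- (2 * b)) * (1 / (x + b)) = (x - b) / (x + b)" if "x > 0" for x
    using that assms by (simp add: field_simps)
qed

text \<open>
  For large \<open>N\<close> the powers of the bump concentrate at \<open>b\<close> but are flat there only to second order.
  The outer power \<open>M\<close> raises the order of contact with \<open>1\<close> to \<open>2 M\<close> and keeps the concentration.
\<close>

definition plateau :: "real \<Rightarrow> nat \<Rightarrow> nat \<Rightarrow> real \<Rightarrow> real" where
  "plateau b M N x = 1 - (1 - bump b x ^ N) ^ M"

lemma laplace_multiplier_plateau: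
  assumes "b > 0" shows "laplace_multiplier (plateau b M N)"
proof (rule laplace_multiplier_cong)
  show "laplace_multiplier (\<lambda>x. 1 + (-1) * (1 + (-1) * bump b x ^ N) ^ M)"
    using assms by (intro laplace_multiplier_mult laplace_multiplier_add laplace_multiplier_const
        laplace_multiplier_power laplace_multiplier_bump)
qed (simp add: plateau_def)

lemma bump_power_bounds:
  assumes "b > 0" "x > 0" shows "0 \<le> bump b x ^ N" "bump b x ^ N \<le> 1"
  using bump_pos[OF assms] bump_le_1[OF assms] by (auto intro: power_le_one)

lemma plateau_bounds:
  assumes "b > 0" "x > 0"
  shows "0 \<le> plateau b M N x" "plateau b M N x \<le> 1" "plateau b M N x \<le> M * bump b x ^ N"
proof -
  note e = bump_power_bounds[OF assms, of N]
  show "0 \<le> plateau b M N x" using e by (simp add: plateau_def power_le_one)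
  show "plateau b M N x \<le> 1" using e by (simp add: plateau_def)
  show "plateau b M N x \<le> M * bump b x ^ N"
    using Bernoulli_inequality[of "- (bump b x ^ N)" M] e by (simp add: plateau_def)
qed

lemma plateau_flat:
  assumes "b > 0" "x > 0"
  shows "1 - plateau b M N x \<le> N ^ M * ((x - b) / (x + b)) ^ (2 * M)"
proof -
  note e = bump_power_bounds[OF assms, of N]
  have "1 - bump b x ^ N \<le> N * (1 - bump b x)"
    using Bernoulli_inequality[of "bump b x - 1" N] bump_pos[OF assms] by (simp add: algebra_simps)
  also have "\<dots> = N * ((x - b) / (x + b))\<^sup>2" using assms by (simp add: bump_eq)
  finally have "(1 - bump b x ^ N) ^ M \<le> (N * ((x - b) / (x + b))\<^sup>2) ^ M"
    using e by (intro power_mono) auto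
  then show ?thesis by (simp add: plateau_def power_mult_distrib power_mult)
qed

section \<open>Multipliers that decrease the form of V\<close>

lemma laplace_energy_nonneg [simp]: "laplace_energy \<rho> \<beta> f x \<ge> 0"
  by (simp add: laplace_energy_def)

lemma laplace_energy_bounded:
  assumes "f \<in> L2_pos" "\<rho> \<ge> 0" "\<beta> > 0"
  obtains C where "C \<ge> 0" "\<And>x. x > 0 \<Longrightarrow> laplace_energy \<rho> \<beta> f x \<le> C"
proof -
  obtain D where D: "D \<ge> 0" "\<And>x. x > 0 \<Longrightarrow> cmod (laplace f x) \<le> D * (1 + 1 / x)"
    using laplace_bound[OF assms(1)] by blast
  show ?thesis
  proof
    fix x :: real assume x: "x > 0"
    have "cmod (laplace f (\<beta> + x)) \<le> D * (1 + 1 / (\<beta> + x))" using D(2) x assms by simp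
    also have "\<dots> \<le> D * (1 + 1 / \<beta>)"
      using D(1) x assms by (intro mult_left_mono add_left_mono divide_left_mono) auto
    finally have "(cmod (laplace f (\<beta> + x)))\<^sup>2 \<le> (D * (1 + 1 / \<beta>))\<^sup>2" by (intro power_mono) auto
    moreover have "exp (- (\<rho> * x)) \<le> 1" using x assms by simp
    ultimately have "exp (- (\<rho> * x)) * (cmod (laplace f (\<beta> + x)))\<^sup>2 \<le> 1 * (D * (1 + 1 / \<beta>))\<^sup>2"
      by (intro mult_mono) auto
    then show "laplace_energy \<rho> \<beta> f x \<le> (D * (1 + 1 / \<beta>))\<^sup>2" by (simp add: laplace_energy_def)
  qed simp
qed

lemma laplace_energy_multiplier:
  assumes "\<And>x. x > 0 \<Longrightarrow> laplace g x = of_real (m x) * laplace f x" "\<beta> > 0" "x > 0"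
  shows "laplace_energy \<rho> \<beta> g x = (m (\<beta> + x))\<^sup>2 * laplace_energy \<rho> \<beta> f x"
  using assms by (simp add: laplace_energy_def norm_mult power_mult_distrib mult_ac)

lemma hankel_form_V_kernel_scale:
  "hankel_form (V_kernel v \<rho> k \<beta>) f = v * hankel_form (V_kernel 1 \<rho> k \<beta>) f"
  using hankel_form_scale[of v "V_kernel 1 \<rho> k \<beta>" f] by (simp add: V_kernel_def[abs_def] mult.assoc)

text \<open>
  Flatness of \<open>m\<close> at \<open>\<beta>\<close> keeps the Taylor polynomial of the energy. If \<open>k\<close> is an integer, this fixes
  the value of the form. Otherwise the regularized integral shrinks with the energy, and the sign
  condition says that its coefficient is nonnegative.
\<close>

lemma hankel_form_decreasing:
  assumes f: "f \<in> L2_pos" and g: "g \<in> L2_pos" and p: "\<rho> \<ge> 0" "\<beta> > 0" "k \<ge> 0"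
    and n: "real n - 1 \<le> k" "k < real n"
    and sign: "k = real n - 1 \<or> 0 \<le> v * (-1) ^ n"
    and mult: "\<And>x. x > 0 \<Longrightarrow> laplace g x = of_real (m x) * laplace f x"
    and m: "\<And>x. x > 0 \<Longrightarrow> 0 \<le> m x" "\<And>x. x > 0 \<Longrightarrow> m x \<le> 1"
    and flat: "\<And>x. 0 < x \<Longrightarrow> x < 1 \<Longrightarrow> 1 - m (\<beta> + x) \<le> D * x ^ n"
  shows "hankel_form (V_kernel v \<rho> k \<beta>) g \<le> hankel_form (V_kernel v \<rho> k \<beta>) f"
proof -
  have E: "laplace_energy \<rho> \<beta> g x = (m (\<beta> + x))\<^sup>2 * laplace_energy \<rho> \<beta> f x" if "x > 0" for x
    by (rule laplace_energy_multiplier[OF mult p(2) that])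
  have msq: "(m (\<beta> + x))\<^sup>2 \<le> 1" if "x > 0" for x
    using m[of "\<beta> + x"] that p by (simp add: power_le_one)
  have mono: "laplace_energy \<rho> \<beta> g x \<le> laplace_energy \<rho> \<beta> f x" if "x > 0" for x
    unfolding E[OF that] using msq[OF that] by (intro mult_left_le_one_le) auto
  obtain C where C: "C \<ge> 0" "\<And>x. x > 0 \<Longrightarrow> laplace_energy \<rho> \<beta> f x \<le> C"
    using laplace_energy_bounded[OF f p(1,2)] by blast
  have close: "\<bar>laplace_energy \<rho> \<beta> f x - laplace_energy \<rho> \<beta> g x\<bar> \<le> (2 * D * C) * x ^ n"
    if x: "0 < x" "x < 1" for x
  proof -
    let ?m = "m (\<beta> + x)"
    have mm: "0 \<le> ?m" "?m \<le> 1" using m[of "\<beta> + x"] x p by auto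
    have "1 - ?m\<^sup>2 = (1 - ?m) * (1 + ?m)" by (simp add: power2_eq_square algebra_simps)
    also have "\<dots> \<le> (D * x ^ n) * 2"
      using mm flat[OF x] by (intro mult_mono) auto
    finally have "(1 - ?m\<^sup>2) * laplace_energy \<rho> \<beta> f x \<le> (D * x ^ n * 2) * C"
      using C(2)[OF x(1)] msq[OF x(1)] by (intro mult_mono) auto
    then show ?thesis using mono[OF x(1)] E[OF x(1)] by (simp add: algebra_simps)
  qed
  have jet: "j < n \<Longrightarrow> hankel_form (V_kernel 1 \<rho> (real j) \<beta>) f = hankel_form (V_kernel 1 \<rho> (real j) \<beta>) g"
      "energy_jet \<rho> \<beta> n f = energy_jet \<rho> \<beta> n g" for j
    using energy_jet_eqI[OF f g p(1,2), of "2 * D * C" n] close by auto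
  show ?thesis
  proof (cases "k = real n - 1")
    case True
    then have "n > 0" "k = real (n - 1)" using p n by (cases n; simp)+
    then show ?thesis
      using jet(1)[of "n - 1"] by (subst (1 2) hankel_form_V_kernel_scale) simp
  next
    case False
    then have k: "real n - 1 < k" using n by simp
    obtain c where c: "c > 0"
      "\<And>f. f \<in> L2_pos \<Longrightarrow> integrable lborel
          (\<lambda>x. indicator {0<..} x * (x powr (- k - 1) * (laplace_energy \<rho> \<beta> f x - energy_jet \<rho> \<beta> n f x)))"
      "\<And>f v. f \<in> L2_pos \<Longrightarrow> hankel_form (V_kernel v \<rho> k \<beta>) f = v * (-1) ^ n / c *
          (LINT x|lborel. indicator {0<..} x * (x powr (- k - 1) * (laplace_energy \<rho> \<beta> f x - energy_jet \<rho> \<beta> n f x)))"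
      using hankel_form_fractional[OF k n(2) p(3) p(1,2)] by blast
    have "(LINT x|lborel. indicator {0<..} x * (x powr (- k - 1) * (laplace_energy \<rho> \<beta> g x - energy_jet \<rho> \<beta> n g x)))
      \<le> (LINT x|lborel. indicator {0<..} x * (x powr (- k - 1) * (laplace_energy \<rho> \<beta> f x - energy_jet \<rho> \<beta> n f x)))"
    proof (rule integral_mono[OF c(2)[OF g] c(2)[OF f]])
      fix x :: real
      show "indicator {0<..} x * (x powr (- k - 1) * (laplace_energy \<rho> \<beta> g x - energy_jet \<rho> \<beta> n g x))
        \<le> indicator {0<..} x * (x powr (- k - 1) * (laplace_energy \<rho> \<beta> f x - energy_jet \<rho> \<beta> n f x))"
        unfolding jet(2) by (cases "x > 0") (auto intro!: mult_left_mono mono)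
    qed
    moreover have "0 \<le> v * (-1) ^ n / c" using sign False c(1) by simp
    ultimately show ?thesis
      unfolding c(3)[OF f] c(3)[OF g] by (rule mult_left_mono)
  qed
qed

section \<open>The form of the unperturbed operator\<close>

definition H0_density :: "real \<Rightarrow> real \<Rightarrow> real \<Rightarrow> real \<Rightarrow> real" where
  "H0_density \<alpha> q r x = indicator {\<alpha><..} x * H0_weight \<alpha> q r x"

lemma H0_density_measurable [measurable]: "H0_density \<alpha> q r \<in> borel_measurable borel"
  unfolding H0_density_def H0_weight_def by measurable

lemma H0_density_nonneg [simp]: "0 \<le> H0_density \<alpha> q r x"
  by (simp add: H0_density_def H0_weight_def)

lemma H0_density_eq_0: "\<alpha> \<ge> 0 \<Longrightarrow> x \<le> 0 \<Longrightarrow> H0_density \<alpha> q r x = 0"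
  by (simp add: H0_density_def)

text \<open>
  For \<open>\<alpha> > 0\<close> the monotonicity of the power uses \<open>q \<ge> 1\<close>.
\<close>

lemma H0_density_le:
  assumes "r \<ge> 0" "(\<alpha> > 0 \<and> q \<ge> 1) \<or> (\<alpha> = 0 \<and> q > 0)" "x > 0"
  shows "H0_density \<alpha> q r x \<le> x powr (q - 1)"
proof (cases "x > \<alpha>")
  case True
  have "(x - \<alpha>) powr (q - 1) \<le> x powr (q - 1)"
    using assms(2) True by (auto intro: powr_mono2)
  moreover have "exp (- r * x) \<le> 1" using assms by simp
  ultimately have "(x - \<alpha>) powr (q - 1) * exp (- r * x) \<le> x powr (q - 1) * 1"
    by (intro mult_mono) auto
  then show ?thesis using True by (simp add: H0_density_def H0_weight_def)
qed (simp add: H0_density_def)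

lemma H0_form_eq:
  "H0_form \<alpha> q r f = exp (\<alpha> * r) / Gamma q * (LINT x|lborel. H0_density \<alpha> q r x * (cmod (laplace f x))\<^sup>2)"
  by (simp add: H0_form_def set_lebesgue_integral_def H0_density_def mult.assoc)

lemma H0_dom_iff:
  "f \<in> H0_dom \<alpha> q r \<longleftrightarrow> f \<in> L2_pos \<and> integrable lborel (\<lambda>x. H0_density \<alpha> q r x * (cmod (laplace f x))\<^sup>2)"
  by (simp add: H0_dom_def set_integrable_def H0_density_def mult.assoc)

lemma H0_form_nonneg: "q > 0 \<Longrightarrow> H0_form \<alpha> q r f \<ge> 0"
  unfolding H0_form_eq by (intro mult_nonneg_nonneg divide_nonneg_nonneg less_imp_le[OF Gamma_real_pos]) auto

lemma integrable_shifted_powr: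
  fixes b e :: real
  assumes "b > 0" "e < -1"
  shows "integrable lborel (\<lambda>x. indicator {0<..} x * (x + b) powr e)"
proof -
  have "has_bochner_integral lborel (\<lambda>x. indicator {b..} x *\<^sub>R x powr e) (-(b powr (e+1)) / (e+1))"
    by (rule has_bochner_integral_of_nonneg_has_integral)
       (use has_integral_powr_to_inf[OF assms(2,1)] in auto)
  then have "integrable lborel (\<lambda>x. indicator {b..} (b + 1 * x) *\<^sub>R (b + 1 * x) powr e)"
    by (intro lborel_integrable_real_affine) (auto simp: has_bochner_integral_iff)
  then show ?thesis
    by (rule Bochner_Integration.integrable_bound) (auto simp: indicator_def add.commute)
qed

text \<open>
  The bump vanishes to first order at \<open>0\<close> and at infinity, so its \<open>2N\<close>-th power beats the growth of
  the density and of \<open>Lf\<close> at both ends once \<open>2N \<ge> q + 3\<close>.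
\<close>

lemma H0_bump_integrable:
  assumes r: "r \<ge> 0" and aq: "(\<alpha> > 0 \<and> q \<ge> 1) \<or> (\<alpha> = 0 \<and> q > 0)"
    and f: "f \<in> L2_pos" and b: "b > 0" and N: "q + 3 \<le> 2 * real N"
  shows "integrable lborel (\<lambda>x. H0_density \<alpha> q r x * (bump b x ^ (2 * N) * (cmod (laplace f x))\<^sup>2))"
proof -
  note [measurable] = laplace_measurable[OF f]
  have q: "q > 0" and a: "\<alpha> \<ge> 0" using aq by auto
  obtain C where C: "C \<ge> 0" "\<And>x. x > 0 \<Longrightarrow> cmod (laplace f x) \<le> C * (1 + 1 / x)"
    using laplace_bound[OF f] by blast
  define D where "D = max 1 (1 / b)"
  define K where "K = (C * D)\<^sup>2 * (4 * b) ^ (2 * N)"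
  let ?e = "q - 1 - 2 * real N"
  let ?g = "\<lambda>x. H0_density \<alpha> q r x * (bump b x ^ (2 * N) * (cmod (laplace f x))\<^sup>2)"
  have le: "norm (?g x) \<le> norm (K * (indicator {0<..} x * (x + b) powr ?e))" for x
  proof (cases "x > 0")
    case x: True
    have D: "D \<ge> 1" "x + 1 \<le> D * (x + b)"
    proof -
      have "x + 1 \<le> D * x + D * b"
        using x b mult_right_mono[of 1 D x] mult_right_mono[of "1 / b" D b]
        by (intro add_mono) (auto simp: D_def)
      then show "x + 1 \<le> D * (x + b)" by (simp add: distrib_left)
    qed (simp add: D_def)
    have "cmod (laplace f x) \<le> C * ((x + 1) / x)" using C(2)[OF x] x by (simp add: field_simps)
    also have "\<dots> \<le> C * (D * (x + b) / x)"
      using C D x by (intro mult_left_mono divide_right_mono) auto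
    finally have L: "(cmod (laplace f x))\<^sup>2 \<le> (C * (D * (x + b) / x))\<^sup>2" by (intro power_mono) auto
    have xb: "x + b > 0" using x b by simp
    have "?g x \<le> x powr (q - 1) * (bump b x ^ (2 * N) * (C * (D * (x + b) / x))\<^sup>2)"
      using H0_density_le[OF r aq x] L bump_power_bounds[OF b x, of "2 * N"]
      by (intro mult_mono mult_left_mono) auto
    also have "\<dots> = K * ((x powr (q - 1) * x ^ (2 * N) / x\<^sup>2) * ((x + b)\<^sup>2 / (x + b) ^ (4 * N)))"
    proof -
      have regroup: "P * (F * (X / Y) * (G * (Z / W))) = G * F * (P * X / W * (Z / Y))"
        for P F X Y G Z W :: real by (simp add: divide_inverse mult_ac)
      have A: "bump b x ^ (2 * N) = (4 * b) ^ (2 * N) * (x ^ (2 * N) / (x + b) ^ (4 * N))"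
        by (simp add: bump_def power_divide power_mult_distrib flip: power_mult)
      have B: "(C * (D * (x + b) / x))\<^sup>2 = (C * D)\<^sup>2 * ((x + b)\<^sup>2 / x\<^sup>2)"
        by (simp add: power_divide power_mult_distrib)
      show ?thesis unfolding K_def A B by (rule regroup)
    qed
    also have "x powr (q - 1) * x ^ (2 * N) / x\<^sup>2 = x powr (q - 3 + 2 * real N)"
      using powr_realpow[OF x, of "2 * N"] powr_realpow[OF x, of 2] powr_add[of x "q - 1" "2 * real N"]
        powr_diff[of x "q - 1 + 2 * real N" 2] by (simp add: algebra_simps)
    also have "(x + b)\<^sup>2 / (x + b) ^ (4 * N) = (x + b) powr (2 - 4 * real N)"
      using powr_realpow[OF xb, of "4 * N"] powr_realpow[OF xb, of 2]
        powr_diff[of "x + b" 2 "4 * real N"] by simp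
    also have "x powr (q - 3 + 2 * real N) * (x + b) powr (2 - 4 * real N)
        \<le> (x + b) powr (q - 3 + 2 * real N) * (x + b) powr (2 - 4 * real N)"
      using x b N q by (intro mult_right_mono powr_mono2) auto
    also have "\<dots> = (x + b) powr ?e"
      using xb by (simp add: algebra_simps flip: powr_add)
    finally have "?g x \<le> K * (x + b) powr ?e" by (simp add: K_def mult_left_mono)
    moreover have "?g x \<ge> 0" using bump_power_bounds[OF b x, of "2 * N"] by simp
    ultimately show ?thesis using x by simp
  qed (simp add: H0_density_eq_0[OF a])
  have "integrable lborel (\<lambda>x. K * (indicator {0<..} x * (x + b) powr ?e))"
    using N q b by (intro integrable_mult_right integrable_shifted_powr) auto
  then show ?thesis
    by (rule Bochner_Integration.integrable_bound) (use le in auto)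
qed

text \<open>
  Dominated convergence: the powers of the bump tend to \<open>0\<close> at every point except \<open>b\<close>, which is a
  null set for the density of \<open>H\<^sub>0\<close>.
\<close>

lemma H0_bump_tendsto_0:
  assumes r: "r \<ge> 0" and aq: "(\<alpha> > 0 \<and> q \<ge> 1) \<or> (\<alpha> = 0 \<and> q > 0)"
    and f: "f \<in> L2_pos" and b: "b > 0"
  shows "(\<lambda>N. LINT x|lborel. H0_density \<alpha> q r x * (bump b x ^ (2 * N) * (cmod (laplace f x))\<^sup>2)) \<longlonglongrightarrow> 0"
proof -
  note [measurable] = laplace_measurable[OF f]
  have a: "\<alpha> \<ge> 0" using aq by auto
  obtain N0 :: nat where "(q + 3) / 2 \<le> real N0" using real_arch_simple by blast
  then have N0: "q + 3 \<le> 2 * real N0" by simp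
  let ?g = "\<lambda>N x. H0_density \<alpha> q r x * (bump b x ^ (2 * N) * (cmod (laplace f x))\<^sup>2)"
  have "(\<lambda>N. LINT x|lborel. ?g (N + N0) x) \<longlonglongrightarrow> integral\<^sup>L lborel (\<lambda>x::real. 0 :: real)"
  proof (rule integral_dominated_convergence[where w = "?g N0"])
    show "integrable lborel (?g N0)" by (rule H0_bump_integrable[OF r aq f b N0])
    show "AE x in lborel. (\<lambda>N. ?g (N + N0) x) \<longlonglongrightarrow> 0"
    proof (rule AE_mp[OF AE_lborel_singleton[of b]], intro AE_I2 impI)
      fix x assume xb: "x \<noteq> b"
      show "(\<lambda>N. ?g (N + N0) x) \<longlonglongrightarrow> 0"
      proof (cases "x > 0")
        case True
        have "(\<lambda>N. bump b x ^ (2 * N)) \<longlonglongrightarrow> 0"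
          using bump_pos[OF b True] bump_less_1[OF b True xb]
          unfolding power_mult by (intro LIMSEQ_power_zero) (auto simp: power_less_one_iff abs_square_less_1)
        then have "(\<lambda>N. bump b x ^ (2 * (N + N0))) \<longlonglongrightarrow> 0" by (rule LIMSEQ_ignore_initial_segment)
        then have "(\<lambda>N. ?g (N + N0) x) \<longlonglongrightarrow> H0_density \<alpha> q r x * (0 * (cmod (laplace f x))\<^sup>2)"
          by (intro tendsto_intros)
        then show ?thesis by simp
      qed (simp add: H0_density_eq_0[OF a])
    qed
    show "AE x in lborel. norm (?g (N + N0) x) \<le> ?g N0 x" for N
    proof (rule AE_I2)
      fix x
      show "norm (?g (N + N0) x) \<le> ?g N0 x"
      proof (cases "x > 0")
        case True
        have "bump b x ^ (2 * (N + N0)) \<le> bump b x ^ (2 * N0)"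
          using bump_pos[OF b True] bump_le_1[OF b True] by (intro power_decreasing) auto
        then show ?thesis
          using bump_power_bounds[OF b True] by (simp add: abs_mult) (intro mult_left_mono mult_right_mono; simp)
      qed (simp add: H0_density_eq_0[OF a])
    qed
  qed measurable
  then have "(\<lambda>N. LINT x|lborel. ?g (N + N0) x) \<longlonglongrightarrow> 0" by simp
  then show ?thesis by (rule LIMSEQ_offset)
qed

lemma cmod_sum_square_le:
  fixes c \<phi> :: "nat \<Rightarrow> complex"
  shows "(cmod (\<Sum>i<n. c i * \<phi> i))\<^sup>2 \<le> (\<Sum>i<n. (cmod (c i))\<^sup>2) * (\<Sum>i<n. (cmod (\<phi> i))\<^sup>2)"
proof -
  have "cmod (\<Sum>i<n. c i * \<phi> i) \<le> (\<Sum>i<n. cmod (c i) * cmod (\<phi> i))"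
    by (rule order_trans[OF norm_sum]) (simp add: norm_mult)
  then have "(cmod (\<Sum>i<n. c i * \<phi> i))\<^sup>2 \<le> (\<Sum>i<n. cmod (c i) * cmod (\<phi> i))\<^sup>2"
    by (intro power_mono) auto
  also have "\<dots> \<le> (\<Sum>i<n. (cmod (c i))\<^sup>2) * (\<Sum>i<n. (cmod (\<phi> i))\<^sup>2)"
    by (rule Cauchy_Schwarz_ineq_sum)
  finally show ?thesis .
qed

section \<open>Negative subspaces that survive the perturbation\<close>

lemma H0_bump_bound:
  assumes r: "r \<ge> 0" and aq: "(\<alpha> > 0 \<and> q \<ge> 1) \<or> (\<alpha> = 0 \<and> q > 0)"
    and f: "\<And>i. i < d \<Longrightarrow> f i \<in> L2_pos" and b: "b > 0" and N: "q + 3 \<le> 2 * real N"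
    and g: "g \<in> L2_pos" and K: "K \<ge> 0"
    and le: "\<And>x. x > 0 \<Longrightarrow> (cmod (laplace g x))\<^sup>2
               \<le> K * (bump b x ^ (2 * N) * (\<Sum>i<d. (cmod (laplace (f i) x))\<^sup>2))"
  shows "g \<in> H0_dom \<alpha> q r"
    and "H0_form \<alpha> q r g \<le> exp (\<alpha> * r) / Gamma q * (K *
          (\<Sum>i<d. LINT x|lborel. H0_density \<alpha> q r x * (bump b x ^ (2 * N) * (cmod (laplace (f i) x))\<^sup>2)))"
proof -
  note [measurable] = laplace_measurable[OF g]
  have a: "\<alpha> \<ge> 0" and q: "q > 0" using aq by auto
  let ?h = "\<lambda>i x. H0_density \<alpha> q r x * (bump b x ^ (2 * N) * (cmod (laplace (f i) x))\<^sup>2)"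
  let ?l = "\<lambda>x. H0_density \<alpha> q r x * (cmod (laplace g x))\<^sup>2"
  have int1: "integrable lborel (?h i)" if "i < d" for i
    by (rule H0_bump_integrable[OF r aq f[OF that] b N])
  have int: "integrable lborel (\<lambda>x. K * (\<Sum>i<d. ?h i x))"
    by (intro integrable_mult_right Bochner_Integration.integrable_sum int1) auto
  have pw: "?l x \<le> K * (\<Sum>i<d. ?h i x)" for x
  proof (cases "x > 0")
    case True
    have "?l x \<le> H0_density \<alpha> q r x * (K * (bump b x ^ (2 * N) * (\<Sum>i<d. (cmod (laplace (f i) x))\<^sup>2)))"
      using le[OF True] by (intro mult_left_mono) auto
    also have "\<dots> = K * (\<Sum>i<d. ?h i x)"
      by (simp add: sum_distrib_left mult_ac)
    finally show ?thesis .
  qed (simp add: H0_density_eq_0[OF a])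
  have gi: "integrable lborel ?l"
    by (rule Bochner_Integration.integrable_bound[OF int])
       (use pw in \<open>auto intro!: AE_I2 order_trans[OF _ abs_ge_self]\<close>)
  then show "g \<in> H0_dom \<alpha> q r" using g by (simp add: H0_dom_iff)
  have "integral\<^sup>L lborel ?l \<le> (LINT x|lborel. K * (\<Sum>i<d. ?h i x))"
    by (rule integral_mono[OF gi int pw])
  also have "\<dots> = K * (LINT x|lborel. (\<Sum>i<d. ?h i x))"
    by (rule integral_mult_right_zero)
  also have "(LINT x|lborel. (\<Sum>i<d. ?h i x)) = (\<Sum>i<d. integral\<^sup>L lborel (?h i))"
    by (rule Bochner_Integration.integral_sum) (use int1 in auto)
  finally show "H0_form \<alpha> q r g \<le> exp (\<alpha> * r) / Gamma q * (K * (\<Sum>i<d. integral\<^sup>L lborel (?h i)))"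
    unfolding H0_form_eq using Gamma_real_pos[OF q] by (intro mult_left_mono) auto
qed

lemma laplace_multiplier_family:
  assumes "laplace_multiplier m" "\<And>i::nat. i < d \<Longrightarrow> f i \<in> L2_pos"
  obtains g where "\<And>i. i < d \<Longrightarrow> g i \<in> L2_pos"
    "\<And>i x. i < d \<Longrightarrow> x > 0 \<Longrightarrow> laplace (g i) x = of_real (m x) * laplace (f i) x"
    "\<And>c x. x > 0 \<Longrightarrow> laplace (lincomb d c g) x = of_real (m x) * laplace (lincomb d c f) x"
proof -
  have "\<forall>i. \<exists>h. i < d \<longrightarrow> h \<in> L2_pos \<and> (\<forall>x>0. laplace h x = of_real (m x) * laplace (f i) x)"
    using assms unfolding laplace_multiplier_def by blast
  then obtain g where g: "\<And>i. i < d \<Longrightarrow> g i \<in> L2_pos"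
    "\<And>i x. i < d \<Longrightarrow> x > 0 \<Longrightarrow> laplace (g i) x = of_real (m x) * laplace (f i) x"
    by metis
  have "laplace (lincomb d c g) x = of_real (m x) * laplace (lincomb d c f) x" if "x > 0" for c x
    using g that assms(2) by (simp add: laplace_lincomb sum_distrib_left mult_ac)
  then show ?thesis using that g by blast
qed

lemma forms_at_zero: "H0_form \<alpha> q r (\<lambda>_. 0) + hankel_form \<kappa> (\<lambda>_. 0) = 0" "(\<lambda>_. 0) \<in> H0_dom \<alpha> q r"
  by (simp_all add: H0_form_eq H0_dom_iff hankel_form_zero laplace_def)

text \<open>
  All functions of the given space are multiplied by the same plateau at \<open>\<beta>\<close>. The form of \<open>V\<close> on the
  space is at most \<open>- \<kappa>\<close> times the squared length of the coefficient vector and does not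
  increase, and for large \<open>N\<close> the form of \<open>H\<^sub>0\<close> is less than \<open>\<kappa>\<close> times that squared length.
\<close>

lemma negative_space_survives:
  assumes r: "r \<ge> 0" and aq: "(\<alpha> > 0 \<and> q \<ge> 1) \<or> (\<alpha> = 0 \<and> q > 0)"
    and p: "\<rho> \<ge> 0" "\<beta> > 0" "k \<ge> 0"
    and n: "real n - 1 \<le> k" "k < real n"
    and sign: "k = real n - 1 \<or> 0 \<le> v * (-1) ^ n"
    and f: "\<And>i. i < d \<Longrightarrow> f i \<in> L2_pos"
    and neg: "\<And>c. \<exists>i<d. c i \<noteq> 0 \<Longrightarrow> hankel_form (V_kernel v \<rho> k \<beta>) (lincomb d c f) < 0"
  shows "enat d \<le> N_minus (H0_dom \<alpha> q r) (\<lambda>f. H0_form \<alpha> q r f + hankel_form (V_kernel v \<rho> k \<beta>) f)"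
proof -
  let ?V = "hankel_form (V_kernel v \<rho> k \<beta>)"
  let ?A = "\<lambda>i j. - inner_pos (hankel (V_kernel v \<rho> k \<beta>) (f i)) (f j)"
  have VA: "Re (\<Sum>i<d. \<Sum>j<d. c i * cnj (c j) * ?A i j) = - ?V (lincomb d c f)" for c
    using hankel_form_lincomb[where c = c, OF f exp_bounded_V_kernel[OF p]]
    by (simp only: mult_minus_right sum_negf minus_complex.simps uminus_complex.simps)
  obtain \<kappa> where \<kappa>: "\<kappa> > 0" "\<And>c. \<kappa> * (\<Sum>i<d. (cmod (c i))\<^sup>2) \<le> - ?V (lincomb d c f)"
    by (rule hermitian_form_lower_bound[of d ?A]; unfold VA) (use neg in auto)
  have q: "q > 0" using aq by auto
  let ?J = "\<lambda>N i. LINT x|lborel. H0_density \<alpha> q r x * (bump \<beta> x ^ (2 * N) * (cmod (laplace (f i) x))\<^sup>2)"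
  let ?C = "exp (\<alpha> * r) / Gamma q"
  have "(\<lambda>N. ?C * ((real n)\<^sup>2 * (\<Sum>i<d. ?J N i))) \<longlonglongrightarrow> ?C * ((real n)\<^sup>2 * (\<Sum>i<d. 0))"
    by (intro tendsto_mult_left tendsto_sum H0_bump_tendsto_0[OF r aq f p(2)]) auto
  then have "\<forall>\<^sub>F N in sequentially. ?C * ((real n)\<^sup>2 * (\<Sum>i<d. ?J N i)) < \<kappa>"
    using \<kappa>(1) by (intro order_tendstoD(2)[where a=\<kappa>]) auto
  moreover obtain N0 :: nat where N0': "(q + 3) / 2 \<le> real N0" using real_arch_simple by blast
  ultimately obtain N where N: "?C * ((real n)\<^sup>2 * (\<Sum>i<d. ?J N i)) < \<kappa>" "N \<ge> N0"
    unfolding eventually_sequentially by (meson linorder_linear)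
  have N0: "q + 3 \<le> 2 * real N0" using N0' by simp
  have N': "q + 3 \<le> 2 * real N" by (rule order_trans[OF N0]) (use N(2) in simp)
  obtain g where g: "\<And>i. i < d \<Longrightarrow> g i \<in> L2_pos"
    "\<And>c x. x > 0 \<Longrightarrow> laplace (lincomb d c g) x = of_real (plateau \<beta> n N x) * laplace (lincomb d c f) x"
    by (rule laplace_multiplier_family[where f = f and d = d, OF laplace_multiplier_plateau[OF p(2), of n N]])
       (use f in auto)
  show ?thesis
  proof (rule N_minus_geI[where g=g])
    fix c :: "nat \<Rightarrow> complex" assume c: "\<exists>i<d. c i \<noteq> 0"
    define S where "S = (\<Sum>i<d. (cmod (c i))\<^sup>2)"
    obtain i0 where "i0 < d" "c i0 \<noteq> 0" using c by blast
    then have S: "S > 0" unfolding S_def by (intro sum_pos2[of _ i0]) auto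
    have Lg: "lincomb d c g \<in> L2_pos" and Lf: "lincomb d c f \<in> L2_pos"
      using g f by (auto intro: L2_pos_lincomb)
    have "(cmod (laplace (lincomb d c g) x))\<^sup>2
       \<le> ((real n)\<^sup>2 * S) * (bump \<beta> x ^ (2 * N) * (\<Sum>i<d. (cmod (laplace (f i) x))\<^sup>2))" if x: "x > 0" for x
    proof -
      have "(plateau \<beta> n N x)\<^sup>2 \<le> (n * bump \<beta> x ^ N)\<^sup>2"
        using plateau_bounds[OF p(2) x, of n N] by (intro power_mono) auto
      moreover have "(cmod (laplace (lincomb d c f) x))\<^sup>2 \<le> S * (\<Sum>i<d. (cmod (laplace (f i) x))\<^sup>2)"
        unfolding S_def using cmod_sum_square_le[of c "\<lambda>i. laplace (f i) x" d] f x by (simp add: laplace_lincomb)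
      ultimately have "(plateau \<beta> n N x)\<^sup>2 * (cmod (laplace (lincomb d c f) x))\<^sup>2
          \<le> (n * bump \<beta> x ^ N)\<^sup>2 * (S * (\<Sum>i<d. (cmod (laplace (f i) x))\<^sup>2))"
        by (intro mult_mono) auto
      moreover have "(n * bump \<beta> x ^ N)\<^sup>2 * (S * Y) = ((real n)\<^sup>2 * S) * (bump \<beta> x ^ (2 * N) * Y)" for Y
        by (simp add: power_mult_distrib power_even_eq)
      moreover have "(cmod (laplace (lincomb d c g) x))\<^sup>2 = (plateau \<beta> n N x)\<^sup>2 * (cmod (laplace (lincomb d c f) x))\<^sup>2"
        unfolding g(2)[OF x] by (simp add: norm_mult power_mult_distrib)
      ultimately show ?thesis by (simp only:)
    qed
    note H = H0_bump_bound[OF r aq f p(2) N' Lg _ this]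
    have "H0_form \<alpha> q r (lincomb d c g) \<le> ?C * ((real n)\<^sup>2 * S * (\<Sum>i<d. ?J N i))"
      using H(2) S by simp
    also have "\<dots> = ?C * ((real n)\<^sup>2 * (\<Sum>i<d. ?J N i)) * S" by simp
    also have "\<dots> < \<kappa> * S" using N(1) S by (intro mult_strict_right_mono)
    also have "\<dots> \<le> - ?V (lincomb d c f)" unfolding S_def by (rule \<kappa>(2))
    finally have "H0_form \<alpha> q r (lincomb d c g) < - ?V (lincomb d c f)" .
    moreover have "?V (lincomb d c g) \<le> ?V (lincomb d c f)"
    proof (rule hankel_form_decreasing[OF Lf Lg p n sign, where m = "plateau \<beta> n N" and D = "real N ^ n * (1 / (2 * \<beta>)) ^ (2 * n)"])
      fix x :: real assume x: "0 < x"
      show "0 \<le> plateau \<beta> n N x" "plateau \<beta> n N x \<le> 1" using plateau_bounds[OF p(2) x] by auto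
      show "laplace (lincomb d c g) x = of_real (plateau \<beta> n N x) * laplace (lincomb d c f) x"
        by (rule g(2)[OF x])
    next
      fix x :: real assume x: "0 < x" "x < 1"
      have "1 - plateau \<beta> n N (\<beta> + x) \<le> N ^ n * (x / (x + 2 * \<beta>)) ^ (2 * n)"
        using plateau_flat[of \<beta> "\<beta> + x" n N] p x by (simp add: algebra_simps)
      also have "\<dots> \<le> N ^ n * (x * (1 / (2 * \<beta>))) ^ (2 * n)"
        using x p by (intro mult_left_mono power_mono) (auto simp: field_simps)
      also have "\<dots> = N ^ n * (1 / (2 * \<beta>)) ^ (2 * n) * x ^ (2 * n)"
        by (simp only: power_mult_distrib mult_ac)
      also have "\<dots> \<le> N ^ n * (1 / (2 * \<beta>)) ^ (2 * n) * x ^ n"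
        using x p by (intro mult_left_mono power_decreasing) auto
      finally show "1 - plateau \<beta> n N (\<beta> + x) \<le> real N ^ n * (1 / (2 * \<beta>)) ^ (2 * n) * x ^ n" by simp
    qed
    ultimately show "lincomb d c g \<in> H0_dom \<alpha> q r \<and> H0_form \<alpha> q r (lincomb d c g) + ?V (lincomb d c g) < 0"
      using H(1) S by auto
  qed (simp_all add: forms_at_zero)
qed

section \<open>Negative subspaces of arbitrary dimension\<close>

lemma exponential_in_L2:
  assumes "b > 0"
  obtains f where "f \<in> L2_pos" "\<And>x. x > 0 \<Longrightarrow> laplace f x = of_real (1 / (x + b))"
proof
  let ?f = "\<lambda>t. of_real (exp_tail b t) :: complex"
  have z: "zext ?f = ?f" by (auto simp: zext_def fun_eq_iff exp_tail_def indicator_def)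
  have sq: "(exp_tail b t)\<^sup>2 = exp_tail (2 * b) t" for t
    by (simp add: exp_tail_def power2_eq_square flip: exp_add)
  show "?f \<in> L2_pos"
    using has_bochner_integral_exp_tail[of "2 * b"] assms
    by (intro L2_posI) (simp_all add: z sq has_bochner_integral_iff)
  fix x :: real assume x: "x > 0"
  have "exp (- (t * x)) *\<^sub>R ?f t = of_real (exp_tail (x + b) t)" for t
    by (auto simp: exp_tail_def scaleR_conv_of_real algebra_simps simp flip: of_real_mult exp_add)
  then have "laplace ?f x = of_real (integral\<^sup>L lborel (exp_tail (x + b)))"
    unfolding laplace_zext z by simp
  then show "laplace ?f x = of_real (1 / (x + b))"
    using has_bochner_integral_exp_tail[of "x + b"] assms x by (simp add: has_bochner_integral_iff)
qed

text \<open>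
  A factor \<open>z\<^sup>n\<close> with \<open>z = (x - \<beta>) / (x + \<beta>)\<close> makes the energy vanish to order \<open>2 n\<close>, hence removes the
  Taylor polynomial from the regularized integral. The result is moved from \<open>0\<close> to \<open>\<beta>\<close>.
\<close>

lemma hankel_form_of_flat:
  assumes f: "f \<in> L2_pos" and g: "g \<in> L2_pos" and p: "\<rho> \<ge> 0" "\<beta> > 0" "k \<ge> 0"
    and n: "real n - 1 < k" "k < real n"
    and gf: "\<And>x. x > 0 \<Longrightarrow> laplace g x = of_real (((x - \<beta>) / (x + \<beta>)) ^ n) * laplace f x"
    and c: "integrable lborel
          (\<lambda>x. indicator {0<..} x * (x powr (- k - 1) * (laplace_energy \<rho> \<beta> g x - energy_jet \<rho> \<beta> n g x)))"
      "hankel_form (V_kernel v \<rho> k \<beta>) g = a *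
          (LINT x|lborel. indicator {0<..} x * (x powr (- k - 1) * (laplace_energy \<rho> \<beta> g x - energy_jet \<rho> \<beta> n g x)))"
  shows "integrable lborel (\<lambda>x. indicator {\<beta><..} x * ((x - \<beta>) powr (- k - 1) * exp (- (\<rho> * (x - \<beta>)))) * (cmod (laplace g x))\<^sup>2)"
    and "hankel_form (V_kernel v \<rho> k \<beta>) g = a *
      (LINT x|lborel. indicator {\<beta><..} x * ((x - \<beta>) powr (- k - 1) * exp (- (\<rho> * (x - \<beta>)))) * (cmod (laplace g x))\<^sup>2)"
proof -
  obtain C where C: "C \<ge> 0" "\<And>x. x > 0 \<Longrightarrow> laplace_energy \<rho> \<beta> f x \<le> C"
    using laplace_energy_bounded[OF f p(1,2)] by blast
  have close: "\<bar>laplace_energy \<rho> \<beta> g x - laplace_energy \<rho> \<beta> (\<lambda>_. 0) x\<bar> \<le> ((1 / (2 * \<beta>)) ^ (2 * n) * C) * x ^ n"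
    if x: "0 < x" "x < 1" for x
  proof -
    have "laplace_energy \<rho> \<beta> g x = (((\<beta> + x - \<beta>) / (\<beta> + x + \<beta>)) ^ n)\<^sup>2 * laplace_energy \<rho> \<beta> f x"
      by (rule laplace_energy_multiplier[OF gf p(2) x(1)])
    also have "\<dots> = (x / (x + 2 * \<beta>)) ^ (2 * n) * laplace_energy \<rho> \<beta> f x"
      by (simp add: algebra_simps flip: power_mult)
    also have "\<dots> \<le> (x * (1 / (2 * \<beta>))) ^ (2 * n) * C"
      using x p C by (intro mult_mono power_mono) (auto simp: field_simps)
    also have "\<dots> = (1 / (2 * \<beta>)) ^ (2 * n) * C * x ^ (2 * n)"
      by (simp only: power_mult_distrib mult_ac)
    also have "\<dots> \<le> (1 / (2 * \<beta>)) ^ (2 * n) * C * x ^ n"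
      using x p C by (intro mult_left_mono power_decreasing) auto
    finally show ?thesis by (simp add: laplace_energy_def laplace_def)
  qed
  have "energy_jet \<rho> \<beta> n g = energy_jet \<rho> \<beta> n (\<lambda>_. 0)"
    using energy_jet_eqI(2)[OF g L2_pos_zero p(1,2), of "(1 / (2 * \<beta>)) ^ (2 * n) * C" n] close by blast
  then have jet: "energy_jet \<rho> \<beta> n g = (\<lambda>_. 0)"
    by (simp add: energy_jet_def hankel_form_zero fun_eq_iff)
  let ?\<phi> = "\<lambda>x. indicator {0<..} x * (x powr (- k - 1) * laplace_energy \<rho> \<beta> g x)"
  have shift: "?\<phi> (- \<beta> + 1 * x) = indicator {\<beta><..} x * ((x - \<beta>) powr (- k - 1) * exp (- (\<rho> * (x - \<beta>)))) * (cmod (laplace g x))\<^sup>2" for x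
    by (auto simp: laplace_energy_def indicator_def)
  have "has_bochner_integral lborel ?\<phi> (integral\<^sup>L lborel ?\<phi>)"
    using c(1) by (simp add: jet has_bochner_integral_iff)
  then have "has_bochner_integral lborel (\<lambda>x. ?\<phi> (- \<beta> + 1 * x)) (integral\<^sup>L lborel ?\<phi>)"
    using lborel_has_bochner_integral_real_affine_iff[of 1 ?\<phi> "integral\<^sup>L lborel ?\<phi>" "- \<beta>"] by simp
  note hb = this[unfolded shift, THEN has_bochner_integral_iff[THEN iffD1]]
  show "integrable lborel (\<lambda>x. indicator {\<beta><..} x * ((x - \<beta>) powr (- k - 1) * exp (- (\<rho> * (x - \<beta>)))) * (cmod (laplace g x))\<^sup>2)"
    using hb by blast
  show "hankel_form (V_kernel v \<rho> k \<beta>) g = a *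
      (LINT x|lborel. indicator {\<beta><..} x * ((x - \<beta>) powr (- k - 1) * exp (- (\<rho> * (x - \<beta>)))) * (cmod (laplace g x))\<^sup>2)"
    using hb c(2) by (simp add: jet)
qed

text \<open>
  After division by \<open>z\<^sup>n / (x + \<beta>)\<close> a combination is a polynomial in \<open>1 / (x + \<beta>)\<close>, which has only
  finitely many zeros. So the \<open>L\<^sup>2\<close> norm on the interval is a norm on the coefficients.
\<close>

lemma flat_family_independent:
  fixes \<beta> l u :: real and n d :: nat
  assumes \<beta>: "\<beta> > 0" "l > 0" and lu: "l < u"
  defines "\<Phi> \<equiv> \<lambda>i x. ((x - \<beta>) / (x + \<beta>)) ^ n * (1 / (x + \<beta>)) ^ Suc i"
  obtains \<kappa> where "\<kappa> > 0"
    "\<And>c. integrable lborel (\<lambda>x. indicator {l..u} x * (cmod (\<Sum>i<d. c i * of_real (\<Phi> i x)))\<^sup>2)"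
    "\<And>c. \<kappa> * (\<Sum>i<d. (cmod (c i))\<^sup>2) \<le> (LINT x|lborel. indicator {l..u} x * (cmod (\<Sum>i<d. c i * of_real (\<Phi> i x)))\<^sup>2)"
proof -
  let ?I = "indicator {l..u} :: real \<Rightarrow> real"
  have cont: "continuous_on {l..u} (\<Phi> i)" for i
    unfolding \<Phi>_def using \<beta> by (intro continuous_intros) auto
  have prodint: "integrable lborel (\<lambda>x. ?I x *\<^sub>R (\<Phi> i x * \<Phi> j x))" for i j
    by (intro borel_integrable_compact continuous_intros cont) auto
  define A where "A i j = complex_of_real (LINT x|lborel. ?I x *\<^sub>R (\<Phi> i x * \<Phi> j x))" for i j :: nat
  have re: "Re (w * of_real y) = Re w * y" for w y by simp
  have expand: "?I x * (cmod (\<Sum>i<d. c i * of_real (\<Phi> i x)))\<^sup>2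
      = (\<Sum>i<d. \<Sum>j<d. Re (c i * cnj (c j)) * (?I x *\<^sub>R (\<Phi> i x * \<Phi> j x)))" for c x
  proof -
    let ?z = "\<Sum>i<d. c i * of_real (\<Phi> i x)"
    have "of_real ((cmod ?z)\<^sup>2) = ?z * cnj ?z" by (rule complex_norm_square)
    also have "\<dots> = (\<Sum>i<d. \<Sum>j<d. (c i * cnj (c j)) * of_real (\<Phi> i x * \<Phi> j x))"
      unfolding cnj_sum sum_product by (intro sum.cong refl) (simp add: mult_ac)
    finally have "Re (of_real ((cmod ?z)\<^sup>2)) = Re (\<Sum>i<d. \<Sum>j<d. (c i * cnj (c j)) * of_real (\<Phi> i x * \<Phi> j x))"
      by (rule arg_cong)
    then have "(cmod ?z)\<^sup>2 = (\<Sum>i<d. \<Sum>j<d. Re (c i * cnj (c j)) * (\<Phi> i x * \<Phi> j x))"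
      by (simp only: Re_complex_of_real Re_sum re)
    then show ?thesis by (simp only: sum_distrib_left real_scaleR_def mult.left_commute)
  qed
  have int: "integrable lborel (\<lambda>x. ?I x * (cmod (\<Sum>i<d. c i * of_real (\<Phi> i x)))\<^sup>2)" for c
    unfolding expand by (intro Bochner_Integration.integrable_sum integrable_mult_right prodint)
  have Q: "Re (\<Sum>i<d. \<Sum>j<d. c i * cnj (c j) * A i j)
      = (LINT x|lborel. ?I x * (cmod (\<Sum>i<d. c i * of_real (\<Phi> i x)))\<^sup>2)" for c
  proof -
    have "(LINT x|lborel. ?I x * (cmod (\<Sum>i<d. c i * of_real (\<Phi> i x)))\<^sup>2)
        = (\<Sum>i<d. \<Sum>j<d. Re (c i * cnj (c j)) * (LINT x|lborel. ?I x *\<^sub>R (\<Phi> i x * \<Phi> j x)))"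
      unfolding expand
      by (subst Bochner_Integration.integral_sum; (intro Bochner_Integration.integrable_sum integrable_mult_right prodint)?)
         (intro sum.cong refl, subst Bochner_Integration.integral_sum; (intro integrable_mult_right prodint)?;
           simp only: integral_mult_right_zero)
    then show ?thesis
      by (simp only: A_def Re_sum re)
  qed
  have pos: "(LINT x|lborel. ?I x * (cmod (\<Sum>i<d. c i * of_real (\<Phi> i x)))\<^sup>2) > 0" if c: "\<exists>i<d. c i \<noteq> 0" for c
  proof (rule ccontr)
    assume "\<not> ?thesis"
    then have "(LINT x|lborel. ?I x * (cmod (\<Sum>i<d. c i * of_real (\<Phi> i x)))\<^sup>2) = 0"
      by (intro antisym integral_nonneg) auto
    then have AE0: "AE x in lborel. ?I x * (cmod (\<Sum>i<d. c i * of_real (\<Phi> i x)))\<^sup>2 = 0"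
      using integral_nonneg_eq_0_iff_AE[OF int[of c]] by simp
    obtain e where e: "d = Suc e" using c by (cases d) auto
    define R where "R = {z. (\<Sum>i\<le>e. c i * z ^ i) = 0}"
    have "finite R"
      unfolding R_def using c e by (subst polyfun_finite_roots) (auto simp: less_Suc_eq_le)
    then have "finite ((\<lambda>z. 1 / Re z - \<beta>) ` R)" by (rule finite_imageI)
    then have "finite (insert \<beta> ((\<lambda>z. 1 / Re z - \<beta>) ` R))" by simp
    then have "AE x in lborel. x \<notin> insert \<beta> ((\<lambda>z. 1 / Re z - \<beta>) ` R)"
      by (intro AE_not_in finite_imp_null_set_lborel)
    with AE0 have "AE x in lborel. x \<notin> {l..u}"
    proof eventually_elim
      case (elim x)
      show ?case
      proof
        assume x: "x \<in> {l..u}"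
        then have xp: "x > 0" using \<beta> by auto
        define z :: complex where "z = of_real (1 / (x + \<beta>))"
        have "(\<Sum>i<d. c i * of_real (\<Phi> i x)) = 0" using elim(1) x by simp
        moreover have "(\<Sum>i<d. c i * of_real (\<Phi> i x))
           = of_real (((x - \<beta>) / (x + \<beta>)) ^ n * (1 / (x + \<beta>))) * (\<Sum>i\<le>e. c i * z ^ i)"
          unfolding e lessThan_Suc_atMost sum_distrib_left
          by (intro sum.cong refl) (simp add: \<Phi>_def z_def mult_ac)
        ultimately have prod0: "of_real (((x - \<beta>) / (x + \<beta>)) ^ n * (1 / (x + \<beta>))) * (\<Sum>i\<le>e. c i * z ^ i) = 0"
          by (rule trans[OF sym, rotated])
        have "x \<noteq> \<beta>" using elim(2) by blast
        then have "((x - \<beta>) / (x + \<beta>)) ^ n * (1 / (x + \<beta>)) \<noteq> 0"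
          using xp \<beta> by simp
        then have "complex_of_real (((x - \<beta>) / (x + \<beta>)) ^ n * (1 / (x + \<beta>))) \<noteq> 0"
          by (simp only: of_real_eq_0_iff not_False_eq_True)
        with prod0 have "(\<Sum>i\<le>e. c i * z ^ i) = 0"
          by (rule mult_left_cancel[THEN iffD1, rotated, OF trans[OF _ mult_zero_right[symmetric]]])
        then have "z \<in> R" by (simp add: R_def)
        moreover have "x = 1 / Re z - \<beta>" by (simp add: z_def)
        ultimately show False using elim(2) by blast
      qed
    qed
    then have "emeasure lborel {l..u} = 0"
      by (subst (asm) AE_iff_measurable[of "{l..u}"]) auto
    then show False using lu by simp
  qed
  show ?thesis
  proof (rule hermitian_form_lower_bound[of d A, unfolded Q])
    show "(LINT x|lborel. ?I x * (cmod (\<Sum>i<d. c i * of_real (\<Phi> i x)))\<^sup>2) > 0" if "\<exists>i<d. c i \<noteq> 0" for c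
      using that by (rule pos)
    fix \<kappa> :: real
    assume "\<kappa> > 0" "\<And>c. \<kappa> * (\<Sum>i<d. (cmod (c i))\<^sup>2) \<le> (LINT x|lborel. ?I x * (cmod (\<Sum>i<d. c i * of_real (\<Phi> i x)))\<^sup>2)"
    then show ?thesis by (rule that[OF _ int])
  qed
qed

text \<open>
  The bump increases to the left of its peak and decreases to the right of it.
\<close>

lemma bump_separates:
  assumes "0 < l" "l < c" "c < u"
  obtains s where "0 < s" "s < 1" "\<And>x. x > 0 \<Longrightarrow> \<not> (l < x \<and> x < u) \<Longrightarrow> bump c x \<le> s"
proof
  let ?s = "max (bump c l) (bump c u)"
  show "0 < ?s" using bump_pos[of c l] assms by simp
  show "?s < 1" using bump_less_1[of c l] bump_less_1[of c u] assms by simp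
  fix x :: real assume x: "x > 0" "\<not> (l < x \<and> x < u)"
  show "bump c x \<le> ?s"
  proof (cases "x \<le> l")
    case True
    have "x * l \<le> c * c" using True assms x by (intro mult_mono) auto
    then have "bump c x \<le> bump c l"
      using True assms x by (intro bump_mono mult_nonneg_nonneg) (auto simp: power2_eq_square)
    then show ?thesis by simp
  next
    case False
    then have ux: "u \<le> x" using x by auto
    have "c * c \<le> x * u" using ux assms x by (intro mult_mono) auto
    then have "bump c x \<le> bump c u"
      using ux assms x by (intro bump_mono mult_nonpos_nonpos) (auto simp: power2_eq_square)
    then show ?thesis by simp
  qed
qed

lemma bump_near_1:
  assumes "c > 0" "s < 1" "\<delta> > 0"
  obtains \<eta> where "0 < \<eta>" "\<eta> < \<delta>" "\<And>x. \<bar>x - c\<bar> \<le> \<eta> \<Longrightarrow> s \<le> bump c x"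
proof -
  have "isCont (bump c) c"
    unfolding bump_def using assms by (intro continuous_intros) auto
  moreover have "bump c c = 1" using assms bump_eq[of c c] by simp
  ultimately have "(bump c \<longlongrightarrow> 1) (at c)" by (simp add: isCont_def)
  then have "\<forall>\<^sub>F x in at c. s < bump c x" using assms(2) by (rule order_tendstoD(1))
  then obtain d where d: "d > 0" "\<And>x. x \<noteq> c \<Longrightarrow> dist x c < d \<Longrightarrow> s < bump c x"
    unfolding eventually_at by blast
  show ?thesis
  proof (rule that[of "min (d / 2) (\<delta> / 2)"])
    fix x assume x: "\<bar>x - c\<bar> \<le> min (d / 2) (\<delta> / 2)"
    show "s \<le> bump c x"
    proof (cases "x = c")
      case True
      then show ?thesis using \<open>bump c c = 1\<close> assms by simp
    next
      case False
      then show ?thesis using d(2)[of x] x d(1) by (simp add: dist_real_def less_imp_le)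
    qed
  qed (use d assms in auto)
qed

text \<open>
  Near \<open>\<beta>\<close> the density of \<open>H\<^sub>0\<close> is bounded, and the density of \<open>V\<close> grows at least like
  \<open>1 / (x - \<beta>)\<close>. If \<open>\<alpha> = 0\<close> and \<open>q < 1\<close>, boundedness uses
  \<open>\<beta> > 0\<close>.
\<close>

lemma singular_part_dominates:
  assumes r: "r \<ge> 0" and aq: "(\<alpha> > 0 \<and> q \<ge> 1) \<or> (\<alpha> = 0 \<and> q > 0)"
    and p: "\<rho> \<ge> 0" "\<beta> > 0" "k \<ge> 0" and "C \<ge> 0" "D > 0"
  obtains \<delta> where "\<delta> > 0"
    "\<And>x. \<beta> < x \<Longrightarrow> x < \<beta> + \<delta> \<Longrightarrow>
      C * H0_density \<alpha> q r x + 1 \<le> D * ((x - \<beta>) powr (- k - 1) * exp (- (\<rho> * (x - \<beta>))))"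
proof
  define B where "B = \<beta> powr (q - 1) + (\<beta> + 1) powr (q - 1)"
  define \<delta> where "\<delta> = min 1 (D * exp (- \<rho>) / (C * B + 1))"
  have CB: "C * B + 1 > 0" using \<open>C \<ge> 0\<close> by (simp add: B_def add_nonneg_pos)
  show "\<delta> > 0" using CB \<open>D > 0\<close> by (simp add: \<delta>_def)
  fix x assume x: "\<beta> < x" "x < \<beta> + \<delta>"
  define y where "y = x - \<beta>"
  have y: "0 < y" "y < 1" "y < D * exp (- \<rho>) / (C * B + 1)" using x by (auto simp: y_def \<delta>_def)
  have "x powr (q - 1) \<le> B"
  proof (cases "q \<ge> 1")
    case True
    then have "x powr (q - 1) \<le> (\<beta> + 1) powr (q - 1)"
      using x y p by (intro powr_mono2) (auto simp: y_def)
    then show ?thesis by (simp add: B_def add_increasing)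
  next
    case False
    then have "x powr (q - 1) \<le> \<beta> powr (q - 1)"
      using x y p by (intro powr_mono2') (auto simp: y_def)
    then show ?thesis by (simp add: B_def add_increasing2)
  qed
  then have "H0_density \<alpha> q r x \<le> B"
    using H0_density_le[OF r aq, of x] x p by simp
  then have "C * H0_density \<alpha> q r x + 1 \<le> C * B + 1"
    using \<open>C \<ge> 0\<close> by (simp add: mult_left_mono)
  also have "\<dots> \<le> D * exp (- \<rho>) / y"
    using y CB by (simp add: field_simps)
  also have "\<dots> = D * (y powr (- 1) * exp (- \<rho>))"
    using y by (simp add: powr_minus divide_inverse)
  also have "\<dots> \<le> D * (y powr (- k - 1) * exp (- (\<rho> * y)))"
    using y p \<open>D > 0\<close> by (intro mult_left_mono mult_mono powr_mono') (auto intro: mult_left_le)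
  finally show "C * H0_density \<alpha> q r x + 1 \<le> D * ((x - \<beta>) powr (- k - 1) * exp (- (\<rho> * (x - \<beta>))))"
    by (simp add: y_def)
qed

text \<open>
  The functions have the Laplace transforms \<open>bump\<^sup>N \<Phi>\<^sub>i\<close> with a peak \<open>\<mu>\<close> in the interval
  \<open>(\<beta>, \<beta> + \<delta>)\<close> on which \<open>V\<close> dominates. The bump is at most \<open>s\<close> off that interval and at least
  \<open>s' > s\<close> on a smaller one. So the positive contribution from outside is of order \<open>s\<^sup>2\<^sup>N\<close>, the negative
  one from inside is at least of order \<open>s'\<^sup>2\<^sup>N\<close>, and the latter prevails for large \<open>N\<close>.
\<close>

lemma negative_spaces_unbounded:
  assumes r: "r \<ge> 0" and aq: "(\<alpha> > 0 \<and> q \<ge> 1) \<or> (\<alpha> = 0 \<and> q > 0)"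
    and p: "\<rho> \<ge> 0" "\<beta> > 0" "k \<ge> 0"
    and n: "real n - 1 < k" "k < real n"
    and sign: "v * (-1) ^ n < 0"
  shows "enat d \<le> N_minus (H0_dom \<alpha> q r) (\<lambda>f. H0_form \<alpha> q r f + hankel_form (V_kernel v \<rho> k \<beta>) f)"
proof -
  let ?V = "hankel_form (V_kernel v \<rho> k \<beta>)"
  let ?C = "exp (\<alpha> * r) / Gamma q"
  let ?\<rho>0 = "H0_density \<alpha> q r"
  have q: "q > 0" and a: "\<alpha> \<ge> 0" using aq by auto
  have C: "?C > 0" using Gamma_real_pos[OF q] by simp
  obtain c\<^sub>0 where c0: "c\<^sub>0 > 0"
    and rep: "\<And>f. f \<in> L2_pos \<Longrightarrow> integrable lborel
          (\<lambda>x. indicator {0<..} x * (x powr (- k - 1) * (laplace_energy \<rho> \<beta> f x - energy_jet \<rho> \<beta> n f x)))"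
      "\<And>f v. f \<in> L2_pos \<Longrightarrow> hankel_form (V_kernel v \<rho> k \<beta>) f = v * (-1) ^ n / c\<^sub>0 *
          (LINT x|lborel. indicator {0<..} x * (x powr (- k - 1) * (laplace_energy \<rho> \<beta> f x - energy_jet \<rho> \<beta> n f x)))"
    using hankel_form_fractional[OF n p(3) p(1,2)] by blast
  define D where "D = - (v * (-1) ^ n / c\<^sub>0)"
  have D: "D > 0" using sign c0 by (simp add: D_def divide_neg_pos)
  define \<sigma> where "\<sigma> x = (x - \<beta>) powr (- k - 1) * exp (- (\<rho> * (x - \<beta>)))" for x
  have \<sigma>0: "\<sigma> x \<ge> 0" for x by (simp add: \<sigma>_def)
  obtain \<delta> where \<delta>: "\<delta> > 0" "\<And>x. \<beta> < x \<Longrightarrow> x < \<beta> + \<delta> \<Longrightarrow> ?C * ?\<rho>0 x + 1 \<le> D * \<sigma> x"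
  proof (rule singular_part_dominates[OF r aq p less_imp_le[OF C] D, folded \<sigma>_def])
    fix \<delta> assume "\<delta> > 0" "\<And>x. \<beta> < x \<Longrightarrow> x < \<beta> + \<delta> \<Longrightarrow> ?C * ?\<rho>0 x + 1 \<le> D * \<sigma> x"
    then show thesis by (rule that)
  qed
  define \<mu> where "\<mu> = \<beta> + \<delta> / 2"
  have \<mu>: "\<mu> > 0" "\<beta> < \<mu>" "\<mu> < \<beta> + \<delta>" using \<delta>(1) p by (auto simp: \<mu>_def)
  obtain s where s: "0 < s" "s < 1" "\<And>x. x > 0 \<Longrightarrow> \<not> (\<beta> < x \<and> x < \<beta> + \<delta>) \<Longrightarrow> bump \<mu> x \<le> s"
    using bump_separates[OF p(2) \<mu>(2,3)] by metis
  define s' where "s' = (1 + s) / 2"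
  have s': "s < s'" "s' < 1" "0 < s'" using s by (auto simp: s'_def)
  obtain \<eta> where \<eta>: "0 < \<eta>" "\<eta> < \<delta> / 2" "\<And>x. \<bar>x - \<mu>\<bar> \<le> \<eta> \<Longrightarrow> s' \<le> bump \<mu> x"
    by (rule bump_near_1[OF \<mu>(1) s'(2), of "\<delta> / 2"]) (use \<delta>(1) in auto)
  let ?I = "{\<mu> - \<eta>..\<mu> + \<eta>}"
  have I: "\<beta> < x \<and> x < \<beta> + \<delta> \<and> s' \<le> bump \<mu> x" if "x \<in> ?I" for x
    using that \<eta> by (auto simp: \<mu>_def abs_le_iff intro!: \<eta>(3))
  define \<Phi> where "\<Phi> i x = ((x - \<beta>) / (x + \<beta>)) ^ n * (1 / (x + \<beta>)) ^ Suc i" for i :: nat and x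
  obtain \<kappa> where \<kappa>: "\<kappa> > 0"
    "\<And>c. integrable lborel (\<lambda>x. indicator ?I x * (cmod (\<Sum>i<d. c i * of_real (\<Phi> i x)))\<^sup>2)"
    "\<And>c. \<kappa> * (\<Sum>i<d. (cmod (c i))\<^sup>2) \<le> (LINT x|lborel. indicator ?I x * (cmod (\<Sum>i<d. c i * of_real (\<Phi> i x)))\<^sup>2)"
  proof (rule flat_family_independent[of \<beta> "\<mu> - \<eta>" "\<mu> + \<eta>" n d, folded \<Phi>_def])
    fix \<kappa> :: real
    assume "\<kappa> > 0" "\<And>c. integrable lborel (\<lambda>x. indicator ?I x * (cmod (\<Sum>i<d. c i * of_real (\<Phi> i x)))\<^sup>2)"
      "\<And>c. \<kappa> * (\<Sum>i<d. (cmod (c i))\<^sup>2) \<le> (LINT x|lborel. indicator ?I x * (cmod (\<Sum>i<d. c i * of_real (\<Phi> i x)))\<^sup>2)"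
    then show thesis by (rule that)
  qed (use p \<eta> \<mu>_def \<delta>(1) in auto)
  obtain f\<^sub>0 where f0: "f\<^sub>0 \<in> L2_pos" "\<And>x. x > 0 \<Longrightarrow> laplace f\<^sub>0 x = of_real (1 / (x + \<beta>))"
    using exponential_in_L2[OF p(2)] by blast
  have "\<exists>h\<in>L2_pos. \<forall>x>0. laplace h x = of_real ((1 / (x + \<beta>)) ^ Suc i)" for i
  proof -
    have "laplace_multiplier (\<lambda>x. (1 / (x + \<beta>)) ^ i)"
      using p(2) by (intro laplace_multiplier_power laplace_multiplier_resolvent)
    then obtain h where "h \<in> L2_pos" "\<forall>x>0. laplace h x = of_real ((1 / (x + \<beta>)) ^ i) * laplace f\<^sub>0 x"
      using f0(1) unfolding laplace_multiplier_def by blast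
    moreover from this(2) have "\<forall>x>0. laplace h x = of_real ((1 / (x + \<beta>)) ^ Suc i)"
      by (simp add: f0(2))
    ultimately show ?thesis by blast
  qed
  then obtain h where h: "\<And>i. h i \<in> L2_pos" "\<And>i x. x > 0 \<Longrightarrow> laplace (h i) x = of_real ((1 / (x + \<beta>)) ^ Suc i)"
    by metis
  have flat: "laplace_multiplier (\<lambda>x. ((x - \<beta>) / (x + \<beta>)) ^ n)"
    using p(2) by (intro laplace_multiplier_power laplace_multiplier_mobius)
  obtain f where f: "\<And>i. i < d \<Longrightarrow> f i \<in> L2_pos"
    "\<And>i x. i < d \<Longrightarrow> x > 0 \<Longrightarrow> laplace (f i) x = of_real (((x - \<beta>) / (x + \<beta>)) ^ n) * laplace (h i) x"
    by (rule laplace_multiplier_family[where f = h and d = d, OF flat]) (use h(1) in auto)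
  have f\<Phi>: "laplace (f i) x = of_real (\<Phi> i x)" if "i < d" "x > 0" for i x
    using f(2)[OF that] h(2)[OF that(2)] by (simp add: \<Phi>_def)
  \<comment> \<open>The power \<open>N0\<close> is kept aside for the integrability against the density of \<open>H\<^sub>0\<close>; the remaining power \<open>j\<close> produces the decay.\<close>
  obtain N0 :: nat where N0': "(q + 3) / 2 \<le> real N0" using real_arch_simple by blast
  have N0: "q + 3 \<le> 2 * real N0" using N0' by simp
  define J where "J = (\<Sum>i<d. LINT x|lborel. ?\<rho>0 x * (bump \<mu> x ^ (2 * N0) * (cmod (laplace (f i) x))\<^sup>2))"
  have "(\<lambda>j. ?C * J * ((s / s')\<^sup>2) ^ j) \<longlonglongrightarrow> ?C * J * 0"
    using s s' by (intro tendsto_mult_left LIMSEQ_power_zero) (auto simp: power_less_one_iff abs_square_less_1)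
  then have "\<forall>\<^sub>F j in sequentially. ?C * J * ((s / s')\<^sup>2) ^ j < \<kappa> * s' ^ (2 * N0)"
    using \<kappa>(1) s' by (intro order_tendstoD(2)) auto
  then obtain j where j: "?C * J * ((s / s')\<^sup>2) ^ j < \<kappa> * s' ^ (2 * N0)"
    using eventually_happens by fastforce
  define N where "N = N0 + j"
  have jN: "?C * J * s ^ (2 * j) < \<kappa> * s' ^ (2 * N)"
  proof -
    have "?C * J * ((s / s')\<^sup>2) ^ j * s' ^ (2 * j) < \<kappa> * s' ^ (2 * N0) * s' ^ (2 * j)"
      using j s' by (intro mult_strict_right_mono) auto
    moreover have "((s / s')\<^sup>2) ^ j * s' ^ (2 * j) = s ^ (2 * j)"
      using s' by (simp add: power_divide flip: power_mult)
    ultimately show ?thesis by (simp add: N_def mult.assoc power_add distrib_left)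
  qed
  obtain w where w: "\<And>i. i < d \<Longrightarrow> w i \<in> L2_pos"
    "\<And>i x. i < d \<Longrightarrow> x > 0 \<Longrightarrow> laplace (w i) x = of_real (bump \<mu> x ^ N) * laplace (h i) x"
    by (rule laplace_multiplier_family[where f = h and d = d, OF laplace_multiplier_power[OF laplace_multiplier_bump[OF \<mu>(1)], of N]])
       (use h(1) in auto)
  obtain g where g: "\<And>i. i < d \<Longrightarrow> g i \<in> L2_pos"
    "\<And>i x. i < d \<Longrightarrow> x > 0 \<Longrightarrow> laplace (g i) x = of_real (((x - \<beta>) / (x + \<beta>)) ^ n) * laplace (w i) x"
    "\<And>c x. x > 0 \<Longrightarrow> laplace (lincomb d c g) x = of_real (((x - \<beta>) / (x + \<beta>)) ^ n) * laplace (lincomb d c w) x"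
    by (rule laplace_multiplier_family[where f = w and d = d, OF flat]) (use w(1) in auto)
  show ?thesis
  proof (rule N_minus_geI[where g=g])
    fix c :: "nat \<Rightarrow> complex" assume c: "\<exists>i<d. c i \<noteq> 0"
    define S where "S = (\<Sum>i<d. (cmod (c i))\<^sup>2)"
    obtain i0 where "i0 < d" "c i0 \<noteq> 0" using c by blast
    then have S: "S > 0" unfolding S_def by (intro sum_pos2[of _ i0]) auto
    let ?G = "lincomb d c g"
    let ?L = "\<lambda>x. (cmod (laplace ?G x))\<^sup>2"
    let ?F = "\<lambda>x. (cmod (\<Sum>i<d. c i * of_real (\<Phi> i x)))\<^sup>2"
    let ?H = "\<lambda>i x. ?\<rho>0 x * (bump \<mu> x ^ (2 * N0) * (cmod (laplace (f i) x))\<^sup>2)"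
    have LG: "?G \<in> L2_pos" and Lw: "lincomb d c w \<in> L2_pos"
      using g(1) w(1) by (auto intro: L2_pos_lincomb)
    have L: "?L x = bump \<mu> x ^ (2 * N) * ?F x" if x: "x > 0" for x
    proof -
      have "laplace ?G x = of_real (bump \<mu> x ^ N) * (\<Sum>i<d. c i * of_real (\<Phi> i x))"
        using x g(1) g(2)[OF _ x] w(2)[OF _ x] h(2)[OF x]
        by (simp add: laplace_lincomb \<Phi>_def sum_distrib_left mult_ac)
      then show ?thesis
        using bump_pos[OF \<mu>(1) x] by (simp add: norm_mult norm_power power_mult_distrib power_even_eq)
    qed
    have F: "?F x \<le> S * (\<Sum>i<d. (cmod (laplace (f i) x))\<^sup>2)" if x: "x > 0" for x
      unfolding S_def using cmod_sum_square_le[of c "\<lambda>i. of_real (\<Phi> i x)" d] f\<Phi>[OF _ x] by simp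
    have LS: "?L x \<le> S * (bump \<mu> x ^ (2 * N0) * (\<Sum>i<d. (cmod (laplace (f i) x))\<^sup>2))" if x: "x > 0" for x
    proof -
      have "bump \<mu> x ^ (2 * N) \<le> bump \<mu> x ^ (2 * N0)"
        using bump_pos[OF \<mu>(1) x] bump_le_1[OF \<mu>(1) x] by (intro power_decreasing) (auto simp: N_def)
      then have "bump \<mu> x ^ (2 * N) * ?F x \<le> bump \<mu> x ^ (2 * N0) * (S * (\<Sum>i<d. (cmod (laplace (f i) x))\<^sup>2))"
        using F[OF x] bump_power_bounds[OF \<mu>(1) x] by (intro mult_mono) auto
      then show ?thesis unfolding L[OF x] by (simp add: mult_ac)
    qed
    have dom: "?G \<in> H0_dom \<alpha> q r"
      by (rule H0_bump_bound(1)[OF r aq f(1) \<mu>(1) N0 LG less_imp_le[OF S] LS])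
    then have i0: "integrable lborel (\<lambda>x. ?\<rho>0 x * ?L x)" by (simp add: H0_dom_iff)
    have VG: "integrable lborel (\<lambda>x. indicator {\<beta><..} x * \<sigma> x * ?L x)"
      "?V ?G = - D * (LINT x|lborel. indicator {\<beta><..} x * \<sigma> x * ?L x)"
      using hankel_form_of_flat[OF Lw LG p n g(3)[of _ c] rep(1)[OF LG] rep(2)[OF LG, of v]]
      by (simp_all add: D_def \<sigma>_def)
    have Hint: "integrable lborel (\<lambda>x. \<Sum>i<d. ?H i x)"
      by (intro Bochner_Integration.integrable_sum H0_bump_integrable[OF r aq f(1) \<mu>(1) N0]) auto
    \<comment> \<open>Inside the interval the combined density is at most \<open>- 1\<close>; outside only the contribution of \<open>H\<^sub>0\<close> is kept.\<close>
    have pw: "?C * (?\<rho>0 x * ?L x) - D * (indicator {\<beta><..} x * \<sigma> x * ?L x)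
       \<le> ?C * S * s ^ (2 * j) * (\<Sum>i<d. ?H i x) - s' ^ (2 * N) * (indicator ?I x * ?F x)" for x
    proof (cases "x > 0")
      case False
      then have "x \<notin> ?I" "x \<notin> {\<beta><..}" using I[of x] p by auto
      then show ?thesis using False by (simp add: H0_density_eq_0[OF a])
    next
      case x: True
      have H0: "0 \<le> ?C * S * s ^ (2 * j) * (\<Sum>i<d. ?H i x)"
        using C S s(1) bump_power_bounds[OF \<mu>(1) x, of "2 * N0"] by (intro mult_nonneg_nonneg sum_nonneg) auto
      show ?thesis
      proof (cases "\<beta> < x \<and> x < \<beta> + \<delta>")
        case True
        have "?C * (?\<rho>0 x * ?L x) - D * (indicator {\<beta><..} x * \<sigma> x * ?L x) = (?C * ?\<rho>0 x - D * \<sigma> x) * ?L x"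
          using True by (simp add: left_diff_distrib)
        also have "\<dots> \<le> (- 1) * ?L x"
          using \<delta>(2)[of x] True by (intro mult_right_mono) auto
        also have "\<dots> \<le> - (s' ^ (2 * N) * (indicator ?I x * ?F x))"
        proof (cases "x \<in> ?I")
          case inI: True
          have "s' ^ (2 * N) \<le> bump \<mu> x ^ (2 * N)"
            using I[OF inI] s' by (intro power_mono) auto
          then have "s' ^ (2 * N) * ?F x \<le> ?L x" unfolding L[OF x] by (intro mult_right_mono) auto
          then show ?thesis using inI by simp
        qed simp
        finally show ?thesis using H0 by linarith
      next
        case False
        then have "x \<notin> ?I" using I by blast
        have "bump \<mu> x ^ (2 * N) = bump \<mu> x ^ (2 * j) * bump \<mu> x ^ (2 * N0)"
          by (simp add: N_def distrib_left power_add mult.commute)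
        also have "\<dots> \<le> s ^ (2 * j) * bump \<mu> x ^ (2 * N0)"
          using s(3)[OF x False] bump_pos[OF \<mu>(1) x] by (intro mult_right_mono power_mono) auto
        finally have "?L x \<le> (s ^ (2 * j) * bump \<mu> x ^ (2 * N0)) * (S * (\<Sum>i<d. (cmod (laplace (f i) x))\<^sup>2))"
          unfolding L[OF x] using F[OF x] s(1) bump_power_bounds[OF \<mu>(1) x] by (intro mult_mono) auto
        then have "?C * (?\<rho>0 x * ?L x) \<le> ?C * (?\<rho>0 x * ((s ^ (2 * j) * bump \<mu> x ^ (2 * N0)) * (S * (\<Sum>i<d. (cmod (laplace (f i) x))\<^sup>2))))"
          using C by (intro mult_left_mono) auto
        also have "\<dots> = ?C * S * s ^ (2 * j) * (\<Sum>i<d. ?H i x)"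
          by (simp add: sum_distrib_left mult_ac)
        finally have "?C * (?\<rho>0 x * ?L x) \<le> ?C * S * s ^ (2 * j) * (\<Sum>i<d. ?H i x)" .
        moreover have "0 \<le> D * (indicator {\<beta><..} x * \<sigma> x * ?L x)"
          using D \<sigma>0 by simp
        ultimately show ?thesis using \<open>x \<notin> ?I\<close> by simp
      qed
    qed
    have "H0_form \<alpha> q r ?G + ?V ?G
        = (LINT x|lborel. ?C * (?\<rho>0 x * ?L x) - D * (indicator {\<beta><..} x * \<sigma> x * ?L x))"
    proof -
      have "(LINT x|lborel. ?C * (?\<rho>0 x * ?L x) - D * (indicator {\<beta><..} x * \<sigma> x * ?L x))
          = (LINT x|lborel. ?C * (?\<rho>0 x * ?L x)) - (LINT x|lborel. D * (indicator {\<beta><..} x * \<sigma> x * ?L x))"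
        by (rule Bochner_Integration.integral_diff) (intro integrable_mult_right i0 VG(1))+
      then show ?thesis unfolding H0_form_eq VG(2) by (simp only: integral_mult_right_zero)
    qed
    also have "\<dots> \<le> (LINT x|lborel. ?C * S * s ^ (2 * j) * (\<Sum>i<d. ?H i x) - s' ^ (2 * N) * (indicator ?I x * ?F x))"
      by (rule integral_mono[OF _ _ pw]) (intro Bochner_Integration.integrable_diff integrable_mult_right i0 VG(1) Hint \<kappa>(2))+
    also have "\<dots> = ?C * S * s ^ (2 * j) * (LINT x|lborel. (\<Sum>i<d. ?H i x)) - s' ^ (2 * N) * (LINT x|lborel. indicator ?I x * ?F x)"
    proof -
      have "(LINT x|lborel. ?C * S * s ^ (2 * j) * (\<Sum>i<d. ?H i x) - s' ^ (2 * N) * (indicator ?I x * ?F x))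
         = (LINT x|lborel. ?C * S * s ^ (2 * j) * (\<Sum>i<d. ?H i x)) - (LINT x|lborel. s' ^ (2 * N) * (indicator ?I x * ?F x))"
        by (rule Bochner_Integration.integral_diff) (intro integrable_mult_right Hint \<kappa>(2))+
      then show ?thesis by (simp only: integral_mult_right_zero)
    qed
    also have "(LINT x|lborel. (\<Sum>i<d. ?H i x)) = J"
      unfolding J_def
      by (rule Bochner_Integration.integral_sum) (use H0_bump_integrable[OF r aq f(1) \<mu>(1) N0] in auto)
    also have "?C * S * s ^ (2 * j) * J - s' ^ (2 * N) * (LINT x|lborel. indicator ?I x * ?F x)
        \<le> ?C * S * s ^ (2 * j) * J - s' ^ (2 * N) * (\<kappa> * S)"
      using \<kappa>(3)[of c] s' by (intro diff_left_mono mult_left_mono) (auto simp: S_def)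
    also have "\<dots> = S * (?C * J * s ^ (2 * j) - \<kappa> * s' ^ (2 * N))" by (simp add: algebra_simps)
    also have "\<dots> < 0" using S jN by (intro mult_pos_neg) auto
    finally show "?G \<in> H0_dom \<alpha> q r \<and> H0_form \<alpha> q r ?G + ?V ?G < 0" using dom by blast
  qed (simp_all add: forms_at_zero)
qed

section \<open>Equality of the numbers of negative eigenvalues\<close>

theorem theorem1p3:
  fixes r \<alpha> q v\<^sub>0 \<rho> \<beta> k :: real
  assumes "r \<ge> 0" and "(\<alpha> > 0 \<and> q \<ge> 1) \<or> (\<alpha> = 0 \<and> q > 0)"
    and "\<rho> \<ge> 0" and "\<beta> > 0" and "k \<ge> 0"
  shows "N_minus (H0_dom \<alpha> q r) (\<lambda>f. H0_form \<alpha> q r f + hankel_form (V_kernel v\<^sub>0 \<rho> k \<beta>) f)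
         = N_minus L2_pos (hankel_form (V_kernel v\<^sub>0 \<rho> k \<beta>))"
proof -
  let ?V = "hankel_form (V_kernel v\<^sub>0 \<rho> k \<beta>)"
  let ?a = "\<lambda>f. H0_form \<alpha> q r f + ?V f"
  have q: "q > 0" using assms(2) by auto
  define n where "n = nat \<lfloor>k\<rfloor> + 1"
  have "real n = of_int \<lfloor>k\<rfloor> + 1" using \<open>k \<ge> 0\<close> by (simp add: n_def)
  then have n: "real n - 1 \<le> k" "k < real n"
    using of_int_floor_le[of k] real_of_int_floor_add_one_gt[of k] by simp_all
  have le: "N_minus (H0_dom \<alpha> q r) ?a \<le> N_minus L2_pos ?V"
    unfolding N_minus_def
  proof (rule Sup_subset_mono, clarify)
    fix B assume B: "finite B" "cfun.independent B" "cfun.span B \<subseteq> H0_dom \<alpha> q r"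
      "\<forall>f\<in>cfun.span B. f \<noteq> 0 \<longrightarrow> ?a f < 0"
    have "?V f < 0" if "f \<in> cfun.span B" "f \<noteq> 0" for f
      using B(4) that H0_form_nonneg[OF q, of \<alpha> r f] by fastforce
    then show "\<exists>B'. enat (card B) = enat (card B') \<and> finite B' \<and> cfun.independent B' \<and>
        cfun.span B' \<subseteq> L2_pos \<and> (\<forall>f\<in>cfun.span B'. f \<noteq> 0 \<longrightarrow> ?V f < 0)"
      using B by (intro exI[of _ B]) (auto simp: H0_dom_def)
  qed
  show ?thesis
  proof (cases "k = real n - 1 \<or> 0 \<le> v\<^sub>0 * (-1) ^ n")
    case True
    have "N_minus L2_pos ?V \<le> N_minus (H0_dom \<alpha> q r) ?a"
      unfolding N_minus_def[of L2_pos]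
    proof (rule Sup_least, clarify)
      fix B assume B: "finite B" "cfun.independent B" "cfun.span B \<subseteq> L2_pos"
        "\<forall>f\<in>cfun.span B. f \<noteq> 0 \<longrightarrow> ?V f < 0"
      obtain b where b: "\<And>i. i < card B \<Longrightarrow> b i \<in> L2_pos"
        "\<And>c. \<exists>i<card B. c i \<noteq> 0 \<Longrightarrow> ?V (lincomb (card B) c b) < 0"
        using negative_subspace_enumeration[OF B] by blast
      show "enat (card B) \<le> N_minus (H0_dom \<alpha> q r) ?a"
        by (rule negative_space_survives[OF assms n True b])
    qed
    then show ?thesis using le by simp
  next
    case False
    then have unbounded: "enat d \<le> N_minus (H0_dom \<alpha> q r) ?a" for d
      using n by (intro negative_spaces_unbounded[OF assms, of n]) auto
    have "N_minus (H0_dom \<alpha> q r) ?a = \<infinity>"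
    proof (cases "N_minus (H0_dom \<alpha> q r) ?a")
      case (enat m)
      then show ?thesis using unbounded[of "Suc m"] by simp
    qed
    then show ?thesis using le by simp
  qed
qed

end
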